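(* For every integer $n\ge 0$, $$\sum_{M\in\mathcal{M}_n(P_1)}x^{\mathrm{cr}(M)}=\sum_{P\in\mathcal{P}_n(\mathbf{3+1})}x^{\mathrm{w}(P)}=\sum_{P\in\mathcal{P}_n(\mathbf{N})}x^{\mathrm{w}(P)}=\sum_{\mu\in\mathcal{D}_n}x^{\mathrm{h}(\mu)}.$$
   Context: Matchings. A matching of length $n$ is a partition of $\{1,2,\ldots,2n\}$ into blocks of size 2, called arcs, written $[a,b]$ with $a<b$ ($a$ the opener, $b$ the closer). A matching is a Stoimenow matching if it contains neither a pair of arcs $[i,\ell],[i+1,k]$ with $i+1<k<\ell$ nor a pair of arcs $[k,j+1],[\ell,j]$ with $k<\ell<j$. $\mathcal{M}_n$ is the set of Stoimenow matchings of length $n$. A matching contains a pattern (another matching) if, after removing some (possibly no) arcs and relabelling the remaining endpoints increasingly by $1,2,\ldots$, one obtains that pattern; otherwise it avoids it. $\mathcal{M}_n(P_1)$ is the set of matchings in $\mathcal{M}_n$ avoiding $P_1=\{[1,3],[2,7],[4,5],[6,8]\}$. A $k$-crossing in $M$ is a set of $k$ arcs $[a_{i_1},b_{i_1}],\ldots,[a_{i_k},b_{i_k}]$ of $M$ with $a_{i_1}<\cdots<a_{i_k}<b_{i_1}<\cdots<b_{i_k}$; $\mathrm{cr}(M)$ is the largest $k$ such that $M$ contains a $k$-crossing ($0$ for the empty matching). Posets. Posets are unlabelled (considered up to isomorphism). $\mathcal{P}_n$ is the set of posets with $n$ elements having no induced subposet isomorphic to $\mathbf{2+2}$ (disjoint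 union of two 2-element chains). $\mathbf{3+1}$ is the disjoint union of a 3-element chain and a 1-element chain; $\mathbf{N}$ is the poset on $\{a,b,c,d\}$ whose strict relations are exactly $a<c$, $a<d$, $b<d$. $\mathcal{P}_n(X)$ is the set of posets in $\mathcal{P}_n$ with no induced subposet isomorphic to $X$. $\mathrm{w}(P)$ is the width of $P$, the maximum size of an antichain. Dyck paths. $\mathcal{D}_n$ is the set of lattice paths from $(0,0)$ to $(2n,0)$ with steps $(1,1)$ and $(1,-1)$ never going below the $x$-axis; $\mathrm{h}(\mu)$ is the maximum $y$-coordinate attained by $\mu$. *)

theory Defs
  imports "HOL-Library.Disjoint_Sets" "HOL-Computational_Algebra.Polynomial"
begin

subsection \<open>Matchings\<close>

definition matching :: "nat \<Rightarrow> nat set set \<Rightarrow> bool" where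
  "matching n M \<longleftrightarrow> partition_on {1..2 * n} M \<and> (\<forall>B\<in>M. card B = 2)"

text \<open>The pair \<open>(a, b)\<close> stands for the arc $[a,b]$ with opener $a$ and closer $b$.\<close>

definition arcs :: "nat set set \<Rightarrow> (nat \<times> nat) set" where
  "arcs M = {(a, b). a < b \<and> {a, b} \<in> M}"

definition stoimenow :: "nat set set \<Rightarrow> bool" where
  "stoimenow M \<longleftrightarrow>
     \<not> (\<exists>i k l. (i, l) \<in> arcs M \<and> (i + 1, k) \<in> arcs M \<and> i + 1 < k \<and> k < l) \<and>
     \<not> (\<exists>k l j. (k, j + 1) \<in> arcs M \<and> (l, j) \<in> arcs M \<and> k < l \<and> l < j)"

text \<open>\<open>N\<close> is the set of arcs that are kept, and \<open>f\<close> is the increasing relabelling of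
  their endpoints by $1, 2, \ldots$\<close>

definition matching_contains :: "nat set set \<Rightarrow> nat set set \<Rightarrow> bool" where
  "matching_contains M P \<longleftrightarrow>
     (\<exists>N\<subseteq>M. \<exists>f. strict_mono_on (\<Union>N) f \<and> f ` \<Union>N = {1..card (\<Union>N)} \<and> (`) f ` N = P)"

definition P1 :: "nat set set" where
  "P1 = {{1, 3}, {2, 7}, {4, 5}, {6, 8}}"

definition stoimenow_matchings :: "nat \<Rightarrow> nat set set set" where
  "stoimenow_matchings n = {M. matching n M \<and> stoimenow M}"

definition stoimenow_matchings_avoiding :: "nat \<Rightarrow> nat set set \<Rightarrow> nat set set set" where
  "stoimenow_matchings_avoiding n P = {M \<in> stoimenow_matchings n. \<not> matching_contains M P}"

text \<open>The list \<open>cs\<close> enumerates the arcs of the crossing so that the concatenation of the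
  openers and the closers, $a_{i_1}, \ldots, a_{i_k}, b_{i_1}, \ldots, b_{i_k}$, is increasing.\<close>

definition crossing :: "nat set set \<Rightarrow> nat \<Rightarrow> (nat \<times> nat) set \<Rightarrow> bool" where
  "crossing M k C \<longleftrightarrow> C \<subseteq> arcs M \<and>
     (\<exists>cs. set cs = C \<and> length cs = k \<and> sorted_wrt (<) (map fst cs @ map snd cs))"

definition cr :: "nat set set \<Rightarrow> nat" where
  "cr M = Max {k. \<exists>C. crossing M k C}"


subsection \<open>Posets\<close>

text \<open>A poset is represented by its reflexive order relation, whose field is the underlying
  set. Isomorphism is the library's \<^const>\<open>iso\<close>; the fact \<open>iso_iff2\<close> says that it is an
  order-preserving and order-reflecting bijection between the fields.\<close>

definition isomorphic :: "'a rel \<Rightarrow> 'b rel \<Rightarrow> bool" where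
  "isomorphic r s \<longleftrightarrow> (\<exists>f. iso r s f)"

definition poset_contains :: "'a rel \<Rightarrow> 'b rel \<Rightarrow> bool" where
  "poset_contains r x \<longleftrightarrow> (\<exists>S\<subseteq>Field r. isomorphic (Restr r S) x)"

definition antichain :: "'a rel \<Rightarrow> 'a set \<Rightarrow> bool" where
  "antichain r A \<longleftrightarrow> A \<subseteq> Field r \<and> (\<forall>x\<in>A. \<forall>y\<in>A. (x, y) \<in> r \<longrightarrow> x = y)"

definition width :: "'a rel \<Rightarrow> nat" where
  "width r = Max (card ` {A. antichain r A})"

definition two_plus_two :: "nat rel" where
  "two_plus_two = Id_on {0, 1, 2, 3} \<union> {(0, 1), (2, 3)}"

definition three_plus_one :: "nat rel" where
  "three_plus_one = Id_on {0, 1, 2, 3} \<union> {(0, 1), (1, 2), (0, 2)}"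

text \<open>Here $a, b, c, d$ are $0, 1, 2, 3$.\<close>

definition N_poset :: "nat rel" where
  "N_poset = Id_on {0, 1, 2, 3} \<union> {(0, 2), (0, 3), (1, 3)}"

definition labelled_posets :: "nat \<Rightarrow> nat rel set" where
  "labelled_posets n = {r. partial_order_on {..<n} r}"

definition unlabelled_posets :: "nat \<Rightarrow> nat rel set set" where
  "unlabelled_posets n =
     labelled_posets n //
       {(r, s). r \<in> labelled_posets n \<and> s \<in> labelled_posets n \<and> isomorphic r s}"

text \<open>Pattern containment and width do not depend on the representative of an isomorphism
  class; see \<open>poset_contains_isomorphic\<close> and \<open>class_width_eq\<close> below.\<close>

definition class_avoids :: "nat rel set \<Rightarrow> nat rel \<Rightarrow> bool" where
  "class_avoids C x \<longleftrightarrow> (\<forall>r\<in>C. \<not> poset_contains r x)"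

definition class_width :: "nat rel set \<Rightarrow> nat" where
  "class_width C = width (SOME r. r \<in> C)"

definition posets_avoiding_22 :: "nat \<Rightarrow> nat rel set set" where
  "posets_avoiding_22 n = {C \<in> unlabelled_posets n. class_avoids C two_plus_two}"

definition posets_avoiding_22_and :: "nat \<Rightarrow> nat rel \<Rightarrow> nat rel set set" where
  "posets_avoiding_22_and n x = {C \<in> posets_avoiding_22 n. class_avoids C x}"

lemma isomorphic_refl: "isomorphic r r"
  unfolding isomorphic_def iso_iff2 by (intro exI[of _ id]) auto

lemma isomorphic_sym:
  assumes "isomorphic r s"
  shows "isomorphic s r"
proof -
  obtain f where f: "bij_betw f (Field r) (Field s)"
    and le: "\<And>a b. a \<in> Field r \<Longrightarrow> b \<in> Field r \<Longrightarrow> (a, b) \<in> r \<longleftrightarrow> (f a, f b) \<in> s"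
    using assms unfolding isomorphic_def iso_iff2 by blast
  let ?g = "inv_into (Field r) f"
  have g: "bij_betw ?g (Field s) (Field r)"
    using f by (rule bij_betw_inv_into)
  have "(a, b) \<in> s \<longleftrightarrow> (?g a, ?g b) \<in> r" if "a \<in> Field s" "b \<in> Field s" for a b
    using le[of "?g a" "?g b"] that bij_betw_inv_into_right[OF f] bij_betwE[OF g] by auto
  with g show ?thesis
    unfolding isomorphic_def iso_iff2 by blast
qed

lemma isomorphic_trans:
  assumes "isomorphic r s" "isomorphic s t"
  shows "isomorphic r t"
proof -
  obtain f where f: "bij_betw f (Field r) (Field s)"
    "\<And>a b. a \<in> Field r \<Longrightarrow> b \<in> Field r \<Longrightarrow> (a, b) \<in> r \<longleftrightarrow> (f a, f b) \<in> s"
    using assms(1) unfolding isomorphic_def iso_iff2 by blast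
  obtain g where g: "bij_betw g (Field s) (Field t)"
    "\<And>a b. a \<in> Field s \<Longrightarrow> b \<in> Field s \<Longrightarrow> (a, b) \<in> s \<longleftrightarrow> (g a, g b) \<in> t"
    using assms(2) unfolding isomorphic_def iso_iff2 by blast
  have "(a, b) \<in> r \<longleftrightarrow> ((g \<circ> f) a, (g \<circ> f) b) \<in> t" if "a \<in> Field r" "b \<in> Field r" for a b
    using that f(2) g(2) bij_betwE[OF f(1)] by simp
  with bij_betw_trans[OF f(1) g(1)] show ?thesis
    unfolding isomorphic_def iso_iff2 by blast
qed

lemma equiv_isomorphic:
  "equiv (labelled_posets n)
     {(r, s). r \<in> labelled_posets n \<and> s \<in> labelled_posets n \<and> isomorphic r s}"
proof (rule equivI)
  show "sym {(r, s). r \<in> labelled_posets n \<and> s \<in> labelled_posets n \<and> isomorphic r s}"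
    by (auto simp: sym_def intro: isomorphic_sym)
  show "trans {(r, s). r \<in> labelled_posets n \<and> s \<in> labelled_posets n \<and> isomorphic r s}"
    unfolding trans_def using isomorphic_trans by blast
qed (auto simp: refl_on_def isomorphic_refl)

lemma poset_contains_isomorphic:
  assumes "isomorphic r s" "poset_contains r x"
  shows "poset_contains s x"
proof -
  obtain f where f: "bij_betw f (Field r) (Field s)"
    and le: "\<And>a b. a \<in> Field r \<Longrightarrow> b \<in> Field r \<Longrightarrow> (a, b) \<in> r \<longleftrightarrow> (f a, f b) \<in> s"
    using assms(1) unfolding isomorphic_def iso_iff2 by blast
  obtain S where S: "S \<subseteq> Field r" "isomorphic (Restr r S) x"
    using assms(2) unfolding poset_contains_def by blast
  have fS: "f ` S \<subseteq> Field s"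
    using f S(1) by (auto simp: bij_betw_def)
  have restr: "Restr s (f ` S) = map_prod f f ` Restr r S"
    using S(1) le by (auto 0 3 simp: image_iff subset_iff)
  have fld: "Field (Restr s (f ` S)) = f ` Field (Restr r S)"
    unfolding restr by (force simp: Field_def)
  have sub: "Field (Restr r S) \<subseteq> S"
    by (auto simp: Field_def)
  have "bij_betw f (Field (Restr r S)) (Field (Restr s (f ` S)))"
    unfolding fld using f sub S(1)
    by (meson bij_betw_def bij_betw_subset subset_trans)
  moreover have "(a, b) \<in> Restr r S \<longleftrightarrow> (f a, f b) \<in> Restr s (f ` S)"
    if "a \<in> Field (Restr r S)" "b \<in> Field (Restr r S)" for a b
  proof -
    have "a \<in> S" "b \<in> S" "a \<in> Field r" "b \<in> Field r" using that sub S(1) by auto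
    then show ?thesis using le by auto
  qed
  ultimately have "isomorphic (Restr r S) (Restr s (f ` S))"
    unfolding isomorphic_def iso_iff2 by blast
  then have "isomorphic (Restr s (f ` S)) x"
    using S(2) isomorphic_sym isomorphic_trans by blast
  with fS show ?thesis unfolding poset_contains_def by blast
qed

lemma antichain_cards_isomorphic:
  assumes "isomorphic r s"
  shows "card ` {A. antichain r A} \<subseteq> card ` {A. antichain s A}"
proof
  fix k assume "k \<in> card ` {A. antichain r A}"
  then obtain A where A: "antichain r A" "k = card A" by blast
  obtain f where f: "bij_betw f (Field r) (Field s)"
    and le: "\<And>a b. a \<in> Field r \<Longrightarrow> b \<in> Field r \<Longrightarrow> (a, b) \<in> r \<longleftrightarrow> (f a, f b) \<in> s"
    using assms unfolding isomorphic_def iso_iff2 by blast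
  have sub: "A \<subseteq> Field r" using A(1) by (simp add: antichain_def)
  have "antichain s (f ` A)"
    unfolding antichain_def
  proof (intro conjI ballI impI)
    show "f ` A \<subseteq> Field s" using f sub by (auto simp: bij_betw_def)
    fix x y assume "x \<in> f ` A" "y \<in> f ` A" and xy: "(x, y) \<in> s"
    then obtain a b where ab: "a \<in> A" "b \<in> A" "x = f a" "y = f b" by blast
    then have "(a, b) \<in> r" using xy le sub by blast
    then show "x = y" using ab A(1) by (auto simp: antichain_def)
  qed
  moreover have "card (f ` A) = k"
    using f sub A(2) by (metis bij_betw_def card_image inj_on_subset)
  ultimately show "k \<in> card ` {A. antichain s A}" by blast
qed

lemma width_isomorphic: "isomorphic r s \<Longrightarrow> width r = width s"
  unfolding width_def
  by (metis antichain_cards_isomorphic isomorphic_sym subset_antisym)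

lemma class_width_eq:
  assumes "C \<in> unlabelled_posets n" "r \<in> C"
  shows "class_width C = width r"
proof -
  have "(SOME r. r \<in> C) \<in> C" using assms(2) by (rule someI)
  then have "isomorphic (SOME r. r \<in> C) r"
    using quotient_eq_iff[OF equiv_isomorphic, of C n C "SOME r. r \<in> C" r] assms
    unfolding unlabelled_posets_def by blast
  then show ?thesis unfolding class_width_def by (rule width_isomorphic)
qed


subsection \<open>Dyck paths\<close>

text \<open>A path is given by the list of the vertical components of its steps: \<open>1\<close> stands for
  $(1,1)$ and \<open>-1\<close> for $(1,-1)$. The sum of the first \<open>k\<close> entries is the height at
  abscissa \<open>k\<close>.\<close>

definition dyck_paths :: "nat \<Rightarrow> int list set" where
  "dyck_paths n = {\<mu>. set \<mu> \<subseteq> {1, -1} \<and> length \<mu> = 2 * n \<and> sum_list \<mu> = 0 \<and>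
     (\<forall>k \<le> length \<mu>. 0 \<le> sum_list (take k \<mu>))}"

definition height :: "int list \<Rightarrow> nat" where
  "height \<mu> = nat (Max ((\<lambda>k. sum_list (take k \<mu>)) ` {..length \<mu>}))"

end

theory Submission
  imports Defs "HOL-Library.Product_Lexorder"
begin

text \<open>
  A $(\mathbf{2+2})$-free poset is an interval order: listing its elements by increasing down-sets
  $D$, the up-set of the $i$-th element is a final segment $\{j : j \ge g_i\}$ with
  $i < g_i \le n$. Ties between equal down-sets are broken by $g$ itself. With $g$ increasing,
  $(\mathbf{3+1})$-freeness says precisely that $g$ is weakly increasing; with $g$ decreasing,
  $\mathbf{N}$-freeness says precisely that the intervals $[i, g_i)$ are laminar. The sorted list of
  the pairs $(|D|, \pm g_i)$ is an isomorphism invariant, so $g$ is unique in both cases. The width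
  depends only on the multiset of the values of $g$, since a maximum antichain consists of all
  intervals through some point, and each multiset of values has exactly one weakly increasing and
  exactly one laminar arrangement. A weakly increasing $g$ is a Dyck path: $g_i$ is the number of
  up steps before the $i$-th down step, and the peaks have heights $g_i - i$.

  For matchings, a nesting in a Stoimenow matching always extends to an occurrence of $P_1$, so
  the $P_1$-avoiding ones are the nonnesting matchings. These are determined by their
  opener-closer words, which are Dyck paths; the arcs over a point of a nonnesting matching form
  a crossing, so $\mathrm{cr}$ is the height.
\<close>

subsection \<open>Interval orders as lists\<close>

text \<open>The entry \<open>g ! i\<close> is the first element above \<open>i\<close>; the value
  \<open>n\<close> means that \<open>i\<close> is maximal.\<close>

definition codes :: "nat \<Rightarrow> nat list set" where
  "codes n = {g. length g = n \<and> (\<forall>i<n. i < g ! i \<and> g ! i \<le> n)}"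

definition code_rel :: "nat list \<Rightarrow> nat rel" where
  "code_rel g = {(i, j). i < length g \<and> j < length g \<and> (i = j \<or> g ! i \<le> j)}"

definition laminar :: "nat list \<Rightarrow> bool" where
  "laminar g \<longleftrightarrow> (\<forall>i j. i < j \<longrightarrow> j < length g \<longrightarrow> j < g ! i \<longrightarrow> g ! j \<le> g ! i)"

lemma codesD:
  assumes "g \<in> codes n"
  shows "length g = n" "i < n \<Longrightarrow> i < g ! i" "i < n \<Longrightarrow> g ! i \<le> n"
  using assms by (auto simp: codes_def)

lemma labelled_posets_iff:
  "r \<in> labelled_posets n \<longleftrightarrow>
     r \<subseteq> {..<n} \<times> {..<n} \<and> (\<forall>i<n. (i, i) \<in> r) \<and> trans r \<and> antisym r"
  by (auto simp: labelled_posets_def order_on_defs refl_on_def)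

lemma Field_labelled_poset: "r \<in> labelled_posets n \<Longrightarrow> Field r = {..<n}"
  by (auto simp: labelled_posets_iff Field_def)

lemma code_rel_labelled_poset:
  assumes "g \<in> codes n"
  shows "code_rel g \<in> labelled_posets n"
proof -
  note g = codesD[OF assms]
  have *: "i < j" if "i < n" "g ! i \<le> j" for i j using g(2)[of i] that by simp
  have iff: "(i, j) \<in> code_rel g \<longleftrightarrow> i < n \<and> j < n \<and> (i = j \<or> g ! i \<le> j)" for i j
    by (simp add: code_rel_def g(1))
  have "trans (code_rel g)"
  proof (rule transI)
    fix i j k assume "(i, j) \<in> code_rel g" "(j, k) \<in> code_rel g"
    then show "(i, k) \<in> code_rel g"
      unfolding iff using *[of j k] by (elim conjE disjE) simp_all
  qed
  moreover have "antisym (code_rel g)"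
    by (rule antisymI) (metis iff * less_asym)
  ultimately show ?thesis
    using g(1) by (auto simp: labelled_posets_iff code_rel_def)
qed

lemma code_rel_iff:
  assumes "g \<in> codes n" "i < n" "j < n"
  shows "(i, j) \<in> code_rel g \<longleftrightarrow> i = j \<or> g ! i \<le> j"
  using assms codesD[OF assms(1)] by (simp add: code_rel_def)

section \<open>Pattern containment in terms of four elements\<close>

text \<open>A map that preserves and reflects the order is injective: \<open>f a = f b\<close> puts
  both \<open>(a, b)\<close> and \<open>(b, a)\<close> into \<open>x\<close>, because
  \<open>r\<close> is reflexive, and \<open>x\<close> is antisymmetric. So an induced copy is just a
  choice of four elements with the right comparisons.\<close>

lemma poset_contains_iff:
  fixes x :: "nat rel"
  assumes r: "r \<in> labelled_posets n"
    and x: "antisym x" "Field x = {0, 1, 2, 3}" "\<forall>a\<in>Field x. (a, a) \<in> x"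
  shows "poset_contains r x \<longleftrightarrow>
    (\<exists>f. (\<forall>a\<in>{0, 1, 2, 3}. f a < n) \<and>
      (\<forall>a\<in>{0, 1, 2, 3}. \<forall>b\<in>{0, 1, 2, 3}. (f a, f b) \<in> r \<longleftrightarrow> (a, b) \<in> x))"
    (is "_ \<longleftrightarrow> ?R")
proof
  assume "poset_contains r x"
  then obtain S where S: "S \<subseteq> Field r" "isomorphic x (Restr r S)"
    unfolding poset_contains_def using isomorphic_sym by blast
  obtain f where f: "bij_betw f (Field x) (Field (Restr r S))"
    "\<And>a b. a \<in> Field x \<Longrightarrow> b \<in> Field x \<Longrightarrow> (a, b) \<in> x \<longleftrightarrow> (f a, f b) \<in> Restr r S"
    using S(2) unfolding isomorphic_def iso_iff2 by blast
  have sub: "Field (Restr r S) \<subseteq> S" by (auto simp: Field_def)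
  have mem: "f a \<in> S" if "a \<in> Field x" for a
    using bij_betwE[OF f(1)] sub that by blast
  have lt: "f a < n" if "a \<in> Field x" for a
    using mem[OF that] S(1) Field_labelled_poset[OF r] by auto
  have iff: "(f a, f b) \<in> r \<longleftrightarrow> (a, b) \<in> x" if "a \<in> Field x" "b \<in> Field x" for a b
    using f(2)[OF that] mem that by blast
  show ?R
    unfolding x(2)[symmetric] using lt iff by blast
next
  assume ?R
  then obtain f where lt: "\<forall>a\<in>Field x. f a < n"
    and h: "\<forall>a\<in>Field x. \<forall>b\<in>Field x. (f a, f b) \<in> r \<longleftrightarrow> (a, b) \<in> x"
    unfolding x(2) by blast
  have h: "(f a, f b) \<in> r \<longleftrightarrow> (a, b) \<in> x" if "a \<in> Field x" "b \<in> Field x" for a b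
    using h that by blast
  have im: "f ` Field x \<subseteq> Field r"
    unfolding Field_labelled_poset[OF r] using lt by blast
  have refl: "(i, i) \<in> r" if "i \<in> Field r" for i
    using r that Field_labelled_poset[OF r] by (auto simp: labelled_posets_iff)
  have "inj_on f (Field x)"
    by (rule inj_onI) (metis h refl im image_subset_iff x(1) antisymD)
  moreover have fld: "Field (Restr r (f ` Field x)) = f ` Field x"
  proof (intro equalityI subsetI)
    fix a assume "a \<in> f ` Field x"
    then have "(a, a) \<in> Restr r (f ` Field x)" using refl im by blast
    then show "a \<in> Field (Restr r (f ` Field x))" by (rule FieldI1)
  qed (auto simp: Field_def)
  ultimately have "bij_betw f (Field x) (Field (Restr r (f ` Field x)))"
    by (simp add: bij_betw_def)
  moreover have "(a, b) \<in> x \<longleftrightarrow> (f a, f b) \<in> Restr r (f ` Field x)"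
    if "a \<in> Field x" "b \<in> Field x" for a b
    using h that by blast
  ultimately have "isomorphic x (Restr r (f ` Field x))"
    unfolding isomorphic_def iso_iff2 by blast
  then show "poset_contains r x"
    unfolding poset_contains_def using im isomorphic_sym by blast
qed

lemma patterns_antisym:
  "antisym two_plus_two" "antisym three_plus_one" "antisym N_poset"
  by (auto simp: two_plus_two_def three_plus_one_def N_poset_def antisym_def)

lemma patterns_Field:
  "Field two_plus_two = {0, 1, 2, 3}" "Field three_plus_one = {0, 1, 2, 3}"
  "Field N_poset = {0, 1, 2, 3}"
  by (auto simp: two_plus_two_def three_plus_one_def N_poset_def Field_def)

lemma patterns_refl:
  "\<forall>a\<in>Field two_plus_two. (a, a) \<in> two_plus_two"
  "\<forall>a\<in>Field three_plus_one. (a, a) \<in> three_plus_one"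
  "\<forall>a\<in>Field N_poset. (a, a) \<in> N_poset"
  unfolding patterns_Field by (auto simp: two_plus_two_def three_plus_one_def N_poset_def)

lemmas contains_iff =
  poset_contains_iff[OF _ patterns_antisym(1) patterns_Field(1) patterns_refl(1)]
  poset_contains_iff[OF _ patterns_antisym(2) patterns_Field(2) patterns_refl(2)]
  poset_contains_iff[OF _ patterns_antisym(3) patterns_Field(3) patterns_refl(3)]

text \<open>The listed conditions determine the whole induced order: by transitivity and
  antisymmetry, any further comparison would give \<open>(a, d) \<in> r\<close> or
  \<open>(c, b) \<in> r\<close> or collapse one of the chains.\<close>

lemma contains_22_iff:
  assumes "r \<in> labelled_posets n"
  shows "poset_contains r two_plus_two \<longleftrightarrow>
    (\<exists>a b c d. {a, b, c, d} \<subseteq> {..<n} \<and> a \<noteq> b \<and> c \<noteq> d \<and>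
      (a, b) \<in> r \<and> (c, d) \<in> r \<and> (a, d) \<notin> r \<and> (c, b) \<notin> r)" (is "_ \<longleftrightarrow> ?R")
proof
  assume "poset_contains r two_plus_two"
  then obtain f where "\<forall>a\<in>{0, 1, 2, 3}. f a < n"
    "\<forall>a\<in>{0, 1, 2, 3}. \<forall>b\<in>{0, 1, 2, 3}. (f a, f b) \<in> r \<longleftrightarrow> (a, b) \<in> two_plus_two"
    unfolding contains_iff(1)[OF assms] by blast
  then have "f 0 < n" "f 1 < n" "f 2 < n" "f 3 < n"
    "(f 0, f 1) \<in> r" "(f 2, f 3) \<in> r" "(f 0, f 3) \<notin> r"
    "(f 2, f 1) \<notin> r" "(f 1, f 0) \<notin> r" "(f 3, f 2) \<notin> r"
    by (simp_all add: two_plus_two_def Id_on_iff)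
  then show ?R
    by (intro exI[of _ "f 0"] exI[of _ "f 1"] exI[of _ "f 2"] exI[of _ "f 3"]) auto
next
  have tr: "trans r" and an: "antisym r" and rf: "\<forall>i<n. (i, i) \<in> r"
    using assms by (auto simp: labelled_posets_iff)
  assume ?R
  then obtain a b c d where *: "(a, b) \<in> r" "(c, d) \<in> r" "(a, d) \<notin> r" "(c, b) \<notin> r"
    "a < n" "b < n" "c < n" "d < n" "a \<noteq> b" "c \<noteq> d" by auto
  have "(b, a) \<notin> r" "(d, c) \<notin> r" "(a, c) \<notin> r" "(c, a) \<notin> r" "(b, c) \<notin> r" "(d, a) \<notin> r"
    "(b, d) \<notin> r" "(d, b) \<notin> r"
    using * tr an by (meson transD antisymD)+
  \<comment> \<open>The embedding is list indexing: it sends 0, 1, 2, 3 to \<open>a\<close>,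
    \<open>b\<close>, \<open>c\<close>, \<open>d\<close>.\<close>
  with * rf show "poset_contains r two_plus_two"
    unfolding contains_iff(1)[OF assms]
    by (intro exI[of _ "(!) [a, b, c, d]"]) (simp add: two_plus_two_def Id_on_iff)
qed

text \<open>If \<open>d\<close> were above \<open>b\<close> or \<open>c\<close> it would be above
  \<open>a\<close>, and if it were below \<open>a\<close> or \<open>b\<close> it would be below
  \<open>c\<close>. The two excluded comparisons thus make \<open>d\<close> incomparable to the
  whole chain.\<close>

lemma contains_31_iff:
  assumes "r \<in> labelled_posets n"
  shows "poset_contains r three_plus_one \<longleftrightarrow>
    (\<exists>a b c d. {a, b, c, d} \<subseteq> {..<n} \<and> a \<noteq> b \<and> b \<noteq> c \<and>
      (a, b) \<in> r \<and> (b, c) \<in> r \<and> (a, d) \<notin> r \<and> (d, c) \<notin> r)" (is "_ \<longleftrightarrow> ?R")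
proof
  assume "poset_contains r three_plus_one"
  then obtain f where "\<forall>a\<in>{0, 1, 2, 3}. f a < n"
    "\<forall>a\<in>{0, 1, 2, 3}. \<forall>b\<in>{0, 1, 2, 3}. (f a, f b) \<in> r \<longleftrightarrow> (a, b) \<in> three_plus_one"
    unfolding contains_iff(2)[OF assms] by blast
  then have "f 0 < n" "f 1 < n" "f 2 < n" "f 3 < n"
    "(f 0, f 1) \<in> r" "(f 1, f 2) \<in> r" "(f 0, f 3) \<notin> r"
    "(f 3, f 2) \<notin> r" "(f 1, f 0) \<notin> r" "(f 2, f 1) \<notin> r"
    by (simp_all add: three_plus_one_def Id_on_iff)
  then show ?R
    by (intro exI[of _ "f 0"] exI[of _ "f 1"] exI[of _ "f 2"] exI[of _ "f 3"]) auto
next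
  have tr: "trans r" and an: "antisym r" and rf: "\<forall>i<n. (i, i) \<in> r"
    using assms by (auto simp: labelled_posets_iff)
  assume ?R
  then obtain a b c d where *: "(a, b) \<in> r" "(b, c) \<in> r" "(a, d) \<notin> r" "(d, c) \<notin> r"
    "a < n" "b < n" "c < n" "d < n" "a \<noteq> b" "b \<noteq> c" by auto
  have "(b, a) \<notin> r" "(c, b) \<notin> r" "(a, c) \<in> r" "(c, a) \<notin> r" "(d, a) \<notin> r" "(d, b) \<notin> r"
    "(b, d) \<notin> r" "(c, d) \<notin> r"
    using * tr an by (meson transD antisymD)+
  with * rf show "poset_contains r three_plus_one"
    unfolding contains_iff(2)[OF assms]
    by (intro exI[of _ "(!) [a, b, c, d]"]) (simp add: three_plus_one_def Id_on_iff)
qed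

text \<open>The three excluded comparisons force the other three to be strict: for instance,
  \<open>a = c\<close> would put \<open>(c, d)\<close> into \<open>r\<close>. Transitivity and
  antisymmetry then exclude all remaining comparisons.\<close>

lemma contains_N_iff:
  assumes "r \<in> labelled_posets n"
  shows "poset_contains r N_poset \<longleftrightarrow>
    (\<exists>a b c d. {a, b, c, d} \<subseteq> {..<n} \<and>
      (a, c) \<in> r \<and> (a, d) \<in> r \<and> (b, d) \<in> r \<and> (b, c) \<notin> r \<and> (c, d) \<notin> r \<and> (a, b) \<notin> r)"
    (is "_ \<longleftrightarrow> ?R")
proof
  assume "poset_contains r N_poset"
  then obtain f where "\<forall>a\<in>{0, 1, 2, 3}. f a < n"
    "\<forall>a\<in>{0, 1, 2, 3}. \<forall>b\<in>{0, 1, 2, 3}. (f a, f b) \<in> r \<longleftrightarrow> (a, b) \<in> N_poset"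
    unfolding contains_iff(3)[OF assms] by blast
  then have "f 0 < n" "f 1 < n" "f 2 < n" "f 3 < n"
    "(f 0, f 2) \<in> r" "(f 0, f 3) \<in> r" "(f 1, f 3) \<in> r"
    "(f 1, f 2) \<notin> r" "(f 2, f 3) \<notin> r" "(f 0, f 1) \<notin> r"
    by (simp_all add: N_poset_def Id_on_iff)
  then show ?R
    by (intro exI[of _ "f 0"] exI[of _ "f 1"] exI[of _ "f 2"] exI[of _ "f 3"]) auto
next
  have tr: "trans r" and an: "antisym r" and rf: "\<forall>i<n. (i, i) \<in> r"
    using assms by (auto simp: labelled_posets_iff)
  assume ?R
  then obtain a b c d where *: "(a, c) \<in> r" "(a, d) \<in> r" "(b, d) \<in> r" "(b, c) \<notin> r"
    "(c, d) \<notin> r" "(a, b) \<notin> r" "a < n" "b < n" "c < n" "d < n" by auto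
  have "a \<noteq> c" "a \<noteq> d" "b \<noteq> d"
    using * tr an by (metis transD)+
  then have "(c, a) \<notin> r" "(d, a) \<notin> r" "(d, b) \<notin> r" "(b, a) \<notin> r" "(c, b) \<notin> r" "(d, c) \<notin> r"
    using * tr an by (meson transD antisymD)+
  with * rf show "poset_contains r N_poset"
    unfolding contains_iff(3)[OF assms]
    by (intro exI[of _ "(!) [a, b, c, d]"]) (simp add: N_poset_def Id_on_iff)
qed

section \<open>Patterns avoided by codes\<close>

text \<open>An occurrence would give the cycle
  \<open>g ! a \<le> b < g ! c \<le> d < g ! a\<close>.\<close>

lemma code_rel_avoids_22:
  assumes "g \<in> codes n"
  shows "\<not> poset_contains (code_rel g) two_plus_two"
proof -
  note [simp] = code_rel_iff[OF assms]
  show ?thesis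
    unfolding contains_22_iff[OF code_rel_labelled_poset[OF assms]]
    by (auto; linarith)
qed

text \<open>An element \<open>d\<close> not above \<open>a\<close> satisfies
  \<open>d < g ! a \<le> b\<close>, so monotonicity gives \<open>g ! d \<le> g ! b \<le> c\<close>
  and \<open>d\<close> is below \<open>c\<close> after all.\<close>

lemma code_rel_avoids_31:
  assumes "g \<in> codes n" "sorted g"
  shows "\<not> poset_contains (code_rel g) three_plus_one"
proof
  note code_rel_iff[OF assms(1), simp]
  assume "poset_contains (code_rel g) three_plus_one"
  then obtain a b c d where *: "a < n" "b < n" "c < n" "d < n" "g ! a \<le> b" "g ! b \<le> c"
    "\<not> g ! a \<le> d" "\<not> g ! d \<le> c"
    unfolding contains_31_iff[OF code_rel_labelled_poset[OF assms(1)]] by auto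
  then have "d \<le> b" by linarith
  then have "g ! d \<le> g ! b"
    using assms codesD(1)[OF assms(1)] * by (intro sorted_nth_mono) auto
  with * show False by linarith
qed

text \<open>An occurrence yields \<open>b < g ! a \<le> c < g ! b \<le> d < g ! c\<close>, so the
  intervals of \<open>b\<close> and \<open>c\<close> cross.\<close>

lemma code_rel_avoids_N:
  assumes "g \<in> codes n" "laminar g"
  shows "\<not> poset_contains (code_rel g) N_poset"
proof
  note code_rel_iff[OF assms(1), simp]
  note g = codesD[OF assms(1)]
  assume "poset_contains (code_rel g) N_poset"
  then obtain a b c d where *: "a < n" "b < n" "c < n" "d < n" "g ! a \<le> c"
    "g ! b \<le> d" "b \<noteq> c" "\<not> g ! b \<le> c" "\<not> g ! c \<le> d" "\<not> g ! a \<le> b"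
    unfolding contains_N_iff[OF code_rel_labelled_poset[OF assms(1)]]
    using g(2) by auto
  then have "b < c" by linarith
  then have "g ! c \<le> g ! b"
    using assms(2) * g(1) by (auto simp: laminar_def)
  with * show False by linarith
qed

section \<open>Canonical codes of isomorphism classes\<close>

definition cnt :: "nat list \<Rightarrow> nat \<Rightarrow> nat" where
  "cnt g t = length (filter (\<lambda>v. v \<le> t) g)"

lemma cnt_card: "cnt g t = card {k. k < length g \<and> g ! k \<le> t}"
  by (simp add: cnt_def length_filter_conv_card)

lemma cnt_mono: "s \<le> t \<Longrightarrow> cnt g s \<le> cnt g t"
  unfolding cnt_card by (intro card_mono) auto

text \<open>\<open>cnt g i\<close> is the size of the down-set of \<open>i\<close> in \<open>code_rel g\<close>, so this says that ties
  between equal down-sets are broken by \<open>\<kappa> \<circ> g\<close>, where \<open>\<kappa>\<close> is the embedding into the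
  integers or its negative.\<close>

definition lex_sorted :: "(nat \<Rightarrow> int) \<Rightarrow> nat list \<Rightarrow> bool" where
  "lex_sorted \<kappa> g \<longleftrightarrow>
     (\<forall>i j. i < j \<longrightarrow> j < length g \<longrightarrow> cnt g i = cnt g j \<longrightarrow> \<kappa> (g ! i) \<le> \<kappa> (g ! j))"

text \<open>This allows the up-sets in the construction below to be recorded by their sizes
  alone.\<close>

lemma upward_closed_interval:
  assumes "J \<subseteq> {..<n}" and up: "\<And>i j. i \<in> J \<Longrightarrow> i \<le> j \<Longrightarrow> j < n \<Longrightarrow> j \<in> J"
  shows "J = {n - card J..<n}"
proof (cases "J = {}")
  case False
  have fin: "finite J" using assms(1) by (rule finite_subset) simp
  have "J = {Min J..<n}"
    using Min_le[OF fin] up[OF Min_in[OF fin False]] assms(1) by auto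
  moreover from this have "card J = n - Min J" by (metis card_atLeastLessThan)
  moreover have "Min J < n" using Min_in[OF fin False] assms(1) by auto
  ultimately show ?thesis by simp
qed simp

text \<open>Without 2+2 the strict down-sets form a chain. List the elements by increasing down-set:
  whatever lies above an element then fills a final segment of the list, and the starting points of
  these segments form the code. Ties are broken by \<open>\<kappa>\<close> of the starting
  point.\<close>

lemma ex_lex_sorted_code:
  assumes r: "r \<in> labelled_posets n" and 22: "\<not> poset_contains r two_plus_two"
  obtains g where "g \<in> codes n" "isomorphic (code_rel g) r" "lex_sorted \<kappa> g"
proof -
  have tr: "trans r" and an: "antisym r" and rf: "\<And>i. i < n \<Longrightarrow> (i, i) \<in> r"
    and sub: "r \<subseteq> {..<n} \<times> {..<n}"
    using r by (auto simp: labelled_posets_iff)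
  define D where "D x = {y. (y, x) \<in> r \<and> y \<noteq> x}" for x
  define U where "U x = {y. (x, y) \<in> r \<and> x \<noteq> y}" for x
  have D_sub: "D x \<subseteq> {..<n}" and U_sub: "U x \<subseteq> {..<n}" for x
    using sub by (auto simp: D_def U_def)
  have fin: "finite (D x)" for x
    using D_sub by (rule finite_subset) simp
  \<comment> \<open>If neither down-set contains the other, some \<open>a\<close> below
    \<open>x\<close> only and some \<open>c\<close> below \<open>y\<close> only span, together with
    \<open>x\<close> and \<open>y\<close>, a copy of 2+2.\<close>
  have chain: "D x \<subseteq> D y \<or> D y \<subseteq> D x" if "x < n" "y < n" for x y
  proof (rule ccontr)
    assume "\<not> ?thesis"
    then obtain a c where ac: "a \<in> D x" "a \<notin> D y" "c \<in> D y" "c \<notin> D x" by blast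
    \<comment> \<open>\<open>D y\<close> omits \<open>y\<close> itself, so
      \<open>a \<notin> D y\<close> gives \<open>(a, y) \<notin> r\<close> only after
      \<open>a = y\<close> is excluded.\<close>
    have "a \<noteq> y"
    proof
      assume "a = y"
      then have "(c, x) \<in> r" "(y, x) \<in> r" using ac tr unfolding D_def by (auto dest: transD)
      then have "c = x" using ac by (simp add: D_def)
      then show False using ac \<open>(y, x) \<in> r\<close> an unfolding D_def by (auto dest: antisymD)
    qed
    moreover have "c \<noteq> x"
    proof
      assume "c = x"
      then have "(a, y) \<in> r" using ac tr unfolding D_def by (auto dest: transD)
      then show False using ac \<open>a \<noteq> y\<close> by (simp add: D_def)
    qed
    moreover have "a < n" "c < n" using ac D_sub by blast+
    ultimately have "\<exists>a b c d. {a, b, c, d} \<subseteq> {..<n} \<and> a \<noteq> b \<and> c \<noteq> d \<and>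
      (a, b) \<in> r \<and> (c, d) \<in> r \<and> (a, d) \<notin> r \<and> (c, b) \<notin> r"
      using ac that unfolding D_def
      by (intro exI[of _ a] exI[of _ x] exI[of _ c] exI[of _ y]) auto
    then show False using 22 contains_22_iff[OF r] by blast
  qed
  \<comment> \<open>The argument of \<open>\<kappa>\<close> is the entry that \<open>x\<close> will
    contribute to the code, so sorting by \<open>key\<close> breaks ties as
    \<open>lex_sorted\<close> demands.\<close>
  define key where "key x = (card (D x), \<kappa> (n - card (U x)))" for x
  define ps where "ps = sort_key key [0..<n]"
  have ps: "length ps = n" "distinct ps" "set ps = {..<n}"
    by (auto simp: ps_def)
  have bij: "bij_betw ((!) ps) {..<n} {..<n}"
    using bij_betw_nth[OF ps(2)] ps(1,3) by simp
  have lt: "ps ! i < n" if "i < n" for i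
    using ps that nth_mem[of i ps] by auto
  have nth_image: "(!) ps ` {k. k < n \<and> ps ! k \<in> S} = S" if S: "S \<subseteq> {..<n}" for S
  proof (intro equalityI subsetI)
    fix x assume x: "x \<in> S"
    then have "x \<in> set ps" using S ps(3) by blast
    then obtain k where "k < n" "x = ps ! k" using ps(1) by (auto simp: in_set_conv_nth)
    then show "x \<in> (!) ps ` {k. k < n \<and> ps ! k \<in> S}" using x by blast
  qed auto
  have key_le: "key (ps ! i) \<le> key (ps ! j)" if "i \<le> j" "j < n" for i j
  proof -
    have "sorted (map key ps)" by (simp add: ps_def)
    from sorted_nth_mono[OF this, of i j] show ?thesis using that ps(1) by simp
  qed
  have D_le: "D (ps ! i) \<subseteq> D (ps ! j)" if "i \<le> j" "j < n" for i j
  proof -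
    have "card (D (ps ! i)) \<le> card (D (ps ! j))"
      using key_le[OF that] by (auto simp: key_def)
    then have "D (ps ! i) = D (ps ! j)" if "D (ps ! j) \<subseteq> D (ps ! i)"
      using card_seteq[OF fin that] by simp
    moreover have "ps ! i < n" "ps ! j < n" using lt that by simp_all
    ultimately show ?thesis using chain by blast
  qed
  define g where "g = map (\<lambda>x. n - card (U x)) ps"
  have len: "length g = n" by (simp add: g_def ps(1))
  have g_nth: "g ! i = n - card (U (ps ! i))" if "i < n" for i
    using that ps(1) by (simp add: g_def)
  have up: "ps ! j \<in> U (ps ! i) \<longleftrightarrow> g ! i \<le> j" if "i < n" "j < n" for i j
  proof -
    \<comment> \<open>These are the positions of the elements above \<open>ps ! i\<close>. Down-sets
      increase along \<open>ps\<close>, so \<open>J\<close> is a final segment, and its size fixes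
      its start.\<close>
    define J where "J = {j. j < n \<and> ps ! j \<in> U (ps ! i)}"
    have J: "J = {n - card J..<n}"
    proof (rule upward_closed_interval)
      fix a b assume "a \<in> J" "a \<le> b" "b < n"
      then have "ps ! i \<in> D (ps ! b)" using D_le[of a b] by (auto simp: J_def D_def U_def)
      then show "b \<in> J" using \<open>b < n\<close> by (auto simp: J_def D_def U_def)
    qed (auto simp: J_def)
    have cJ: "card J = card (U (ps ! i))"
    proof (rule bij_betw_same_card)
      have "(!) ps ` J = U (ps ! i)"
        unfolding J_def by (rule nth_image) (rule U_sub)
      then show "bij_betw ((!) ps) J (U (ps ! i))"
        using bij by (auto simp: bij_betw_def J_def intro: inj_on_subset)
    qed
    have "ps ! j \<in> U (ps ! i) \<longleftrightarrow> j \<in> J" using that by (simp add: J_def)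
    also have "\<dots> \<longleftrightarrow> g ! i \<le> j"
      by (subst J) (simp add: that cJ g_nth)
    finally show ?thesis .
  qed
  have code: "g \<in> codes n"
  proof -
    have "i < g ! i" if "i < n" for i
      using up[OF that that] by (auto simp: U_def)
    then show ?thesis using len g_nth by (auto simp: codes_def)
  qed
  have "(i, j) \<in> code_rel g \<longleftrightarrow> (ps ! i, ps ! j) \<in> r" if "i < n" "j < n" for i j
    using code_rel_iff[OF code that] up[OF that] rf lt that nth_eq_iff_index_eq[OF ps(2)] ps(1)
    by (auto simp: U_def)
  then have "isomorphic (code_rel g) r"
    unfolding isomorphic_def iso_iff2
    using bij Field_labelled_poset[OF r] Field_labelled_poset[OF code_rel_labelled_poset[OF code]]
    by auto
  moreover have "lex_sorted \<kappa> g"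
  proof -
    have cnt: "cnt g i = card (D (ps ! i))" if "i < n" for i
    proof -
      have "{k. k < n \<and> g ! k \<le> i} = {k. k < n \<and> ps ! k \<in> D (ps ! i)}"
        using up[OF _ that] by (auto simp: D_def U_def)
      then have "(!) ps ` {k. k < n \<and> g ! k \<le> i} = D (ps ! i)"
        using nth_image[OF D_sub] by simp
      then have "bij_betw ((!) ps) {k. k < n \<and> g ! k \<le> i} (D (ps ! i))"
        using bij by (auto simp: bij_betw_def intro: inj_on_subset)
      then show ?thesis unfolding cnt_card len by (rule bij_betw_same_card)
    qed
    show ?thesis
      unfolding lex_sorted_def len
    proof (intro allI impI)
      fix i j assume "i < j" "j < n" "cnt g i = cnt g j"
      then show "\<kappa> (g ! i) \<le> \<kappa> (g ! j)"
        using key_le[of i j] by (simp add: key_def cnt g_nth)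
    qed
  qed
  ultimately show ?thesis using code that by blast
qed

text \<open>An isomorphism preserves the sizes of up-sets and down-sets, hence the multiset of pairs
  formed from \<open>cnt g i\<close> and \<open>\<kappa> (g ! i)\<close>. Both codes list these
  pairs in sorted order, and \<open>\<kappa>\<close> is injective.\<close>

lemma lex_sorted_code_unique:
  assumes g: "g \<in> codes n" "lex_sorted \<kappa> g" and g': "g' \<in> codes n" "lex_sorted \<kappa> g'"
    and iso: "isomorphic (code_rel g) (code_rel g')" and inj: "inj \<kappa>"
  shows "g = g'"
proof -
  note len = codesD(1)[OF g(1)] codesD(1)[OF g'(1)]
  have fld: "Field (code_rel g) = {..<n}" "Field (code_rel g') = {..<n}"
    using g(1) g'(1) code_rel_labelled_poset Field_labelled_poset by blast+
  obtain h where h: "bij_betw h {..<n} {..<n}"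
    and iff: "\<And>i j. i < n \<Longrightarrow> j < n \<Longrightarrow> (i, j) \<in> code_rel g \<longleftrightarrow> (h i, h j) \<in> code_rel g'"
    using iso unfolding isomorphic_def iso_iff2 fld by auto
  have lt: "h i < n" if "i < n" for i
    using bij_betwE[OF h] that by auto
  \<comment> \<open>For \<open>i = j\<close> both sides are false, since entries of a code exceed
    their positions; otherwise this is the isomorphism property.\<close>
  have less: "g ! i \<le> j \<longleftrightarrow> g' ! h i \<le> h j" if "i < n" "j < n" for i j
  proof (cases "i = j")
    case True
    then show ?thesis
      using codesD(2)[OF g(1), of i] codesD(2)[OF g'(1), of "h i"] that lt[of i] by auto
  next
    case False
    then have "h i \<noteq> h j" using h that by (auto simp: bij_betw_def inj_on_def)
    then show ?thesis
      using iff[OF that] code_rel_iff[OF g(1) that] code_rel_iff[OF g'(1) lt lt, OF that] False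
      by simp
  qed
  \<comment> \<open>Used to carry cardinalities across \<open>h\<close>, first for up-sets and then
    for down-sets.\<close>
  have img: "bij_betw h {j. j < n \<and> P (h j)} {j. j < n \<and> P j}" for P
  proof -
    have "h ` {j. j < n \<and> P (h j)} = {j. j < n \<and> P j}"
    proof (intro equalityI subsetI)
      fix k assume k: "k \<in> {j. j < n \<and> P j}"
      then have "k \<in> h ` {..<n}" using h by (simp add: bij_betw_def)
      then show "k \<in> h ` {j. j < n \<and> P (h j)}" using k by blast
    qed (use lt in auto)
    then show ?thesis using h by (auto simp: bij_betw_def intro: inj_on_subset)
  qed
  have val: "g ! i = g' ! h i" if "i < n" for i
  proof -
    have "card {j. j < n \<and> g ! i \<le> j} = card {j. j < n \<and> g' ! h i \<le> h j}"
      using less[OF that] by (intro arg_cong[of _ _ card]) auto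
    also have "\<dots> = card {j. j < n \<and> g' ! h i \<le> j}"
      using bij_betw_same_card[OF img] .
    finally have "card {g ! i..<n} = card {g' ! h i..<n}"
      by (simp add: atLeastLessThan_def atLeast_def lessThan_def Int_def conj_commute)
    then show ?thesis
      using codesD(3)[OF g(1) that] codesD(3)[OF g'(1) lt[OF that]] by simp
  qed
  have cnt: "cnt g i = cnt g' (h i)" if "i < n" for i
  proof -
    have "card {k. k < n \<and> g ! k \<le> i} = card {k. k < n \<and> g' ! h k \<le> h i}"
      using less[OF _ that] by (intro arg_cong[of _ _ card]) auto
    also have "\<dots> = card {k. k < n \<and> g' ! k \<le> h i}"
      using bij_betw_same_card[OF img] .
    finally show ?thesis by (simp add: cnt_card len)
  qed
  define L where "L g = map (\<lambda>i. (cnt g i, \<kappa> (g ! i))) [0..<n]" for g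
  have srt: "sorted (L g)" if "lex_sorted \<kappa> g" "length g = n" for g
    unfolding sorted_iff_nth_mono_less
  proof (intro allI impI)
    fix i j assume "i < j" "j < length (L g)"
    then show "L g ! i \<le> L g ! j"
      using that cnt_mono[of i j g] by (force simp: L_def lex_sorted_def)
  qed
  have "mset (L g) = image_mset (\<lambda>i. (cnt g i, \<kappa> (g ! i))) (mset_set {..<n})"
    unfolding L_def mset_map mset_upt by (simp add: atLeast0LessThan)
  also have "\<dots> = image_mset (\<lambda>i. (cnt g' i, \<kappa> (g' ! i))) (image_mset h (mset_set {..<n}))"
    by (auto simp: multiset.map_comp cnt val intro!: image_mset_cong)
  also have "image_mset h (mset_set {..<n}) = mset_set {..<n}"
    using h by (simp add: bij_betw_def image_mset_mset_set)
  also have "image_mset (\<lambda>i. (cnt g' i, \<kappa> (g' ! i))) (mset_set {..<n}) = mset (L g')"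
    unfolding L_def mset_map mset_upt by (simp add: atLeast0LessThan)
  finally have "L g = L g'"
    using srt g(2) g'(2) len properties_for_sort by metis
  show ?thesis
  proof (rule nth_equalityI)
    fix i assume "i < length g"
    then have "L g ! i = L g' ! i" "i < n" using \<open>L g = L g'\<close> len by simp_all
    then show "g ! i = g' ! i" using inj by (simp add: L_def inj_eq)
  qed (simp add: len)
qed

text \<open>Existence and uniqueness of the lexicographically sorted code give one representative
  \<open>code_rel g\<close> per isomorphism class. The pattern \<open>x\<close>, the weight
  \<open>F\<close> and the tie-breaking \<open>\<kappa>\<close> stay arbitrary, so that both poset
  families are covered.\<close>

lemma sum_posets_avoiding:
  fixes \<kappa> :: "nat \<Rightarrow> int"
  assumes "inj \<kappa>"
  shows "(\<Sum>C\<in>posets_avoiding_22_and n x. F (class_width C)) =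
    (\<Sum>g | g \<in> codes n \<and> lex_sorted \<kappa> g \<and> \<not> poset_contains (code_rel g) x.
       F (width (code_rel g)))"
proof -
  define R where
    "R = {(r, s). r \<in> labelled_posets n \<and> s \<in> labelled_posets n \<and> isomorphic r s}"
  define T where "T = {g. g \<in> codes n \<and> lex_sorted \<kappa> g \<and> \<not> poset_contains (code_rel g) x}"
  have eq: "equiv (labelled_posets n) R" unfolding R_def by (rule equiv_isomorphic)
  have unl: "unlabelled_posets n = labelled_posets n // R"
    by (simp add: unlabelled_posets_def R_def)
  have lab: "code_rel g \<in> labelled_posets n" if "g \<in> T" for g
    using that code_rel_labelled_poset by (simp add: T_def)
  have "bij_betw (\<lambda>g. R `` {code_rel g}) T (posets_avoiding_22_and n x)"
  proof (rule bij_betwI')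
    fix g g' assume "g \<in> T" "g' \<in> T"
    then show "R `` {code_rel g} = R `` {code_rel g'} \<longleftrightarrow> g = g'"
      using lex_sorted_code_unique[of g n \<kappa> g'] eq_equiv_class[OF _ eq, of "code_rel g" "code_rel g'"]
        lab[of g'] assms by (auto simp: T_def R_def)
  next
    fix g assume g: "g \<in> T"
    have "\<not> poset_contains s y" if "\<not> poset_contains (code_rel g) y" "s \<in> R `` {code_rel g}" for s y
      using that poset_contains_isomorphic isomorphic_sym unfolding R_def by blast
    then have "class_avoids (R `` {code_rel g}) y" if "\<not> poset_contains (code_rel g) y" for y
      using that by (auto simp: class_avoids_def)
    then show "R `` {code_rel g} \<in> posets_avoiding_22_and n x"
      using g lab[OF g] code_rel_avoids_22[of g n]
      by (simp add: posets_avoiding_22_and_def posets_avoiding_22_def unl quotientI T_def)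
  next
    fix C assume C: "C \<in> posets_avoiding_22_and n x"
    then have "C \<in> labelled_posets n // R"
      by (simp add: posets_avoiding_22_and_def posets_avoiding_22_def unl)
    then obtain r where r: "r \<in> labelled_posets n" "C = R `` {r}" by (rule quotientE)
    then have "r \<in> C" using eq equiv_class_self by fast
    then have "\<not> poset_contains r two_plus_two" "\<not> poset_contains r x"
      using C by (auto simp: posets_avoiding_22_and_def posets_avoiding_22_def class_avoids_def)
    then obtain g where g: "g \<in> codes n" "isomorphic (code_rel g) r" "lex_sorted \<kappa> g"
      using ex_lex_sorted_code[OF r(1)] by metis
    then have "g \<in> T"
      using poset_contains_isomorphic \<open>\<not> poset_contains r x\<close> by (auto simp: T_def)
    moreover have "C = R `` {code_rel g}"
      using equiv_class_eq[OF eq, of "code_rel g" r] g r code_rel_labelled_poset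
      by (auto simp: R_def)
    ultimately show "\<exists>g\<in>T. C = R `` {code_rel g}" by blast
  qed
  then have "(\<Sum>C\<in>posets_avoiding_22_and n x. F (class_width C)) =
      (\<Sum>g\<in>T. F (class_width (R `` {code_rel g})))"
    by (rule sum.reindex_bij_betw[symmetric])
  also have "\<dots> = (\<Sum>g\<in>T. F (width (code_rel g)))"
  proof (rule sum.cong[OF refl])
    fix g assume "g \<in> T"
    then have "class_width (R `` {code_rel g}) = width (code_rel g)"
      using lab[of g] quotientI[of "code_rel g"] equiv_class_self[OF eq, of "code_rel g"]
      by (intro class_width_eq[of _ n]) (auto simp: unl)
    then show "F (class_width (R `` {code_rel g})) = F (width (code_rel g))" by simp
  qed
  finally show ?thesis by (simp add: T_def)
qed

section \<open>Codes of the two poset families\<close>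

text \<open>Suppose \<open>i < j\<close> and \<open>g ! j < g ! i\<close>. The tie-breaking rules
  out equal down-sets, so some \<open>m\<close> is below \<open>j\<close> but not below
  \<open>i\<close>. Then \<open>m\<close>, \<open>j\<close>, \<open>g ! j\<close> is a chain and
  \<open>i\<close> is incomparable to it.\<close>

lemma code_eq_sorted:
  assumes "g \<in> codes n"
  shows "lex_sorted int g \<and> \<not> poset_contains (code_rel g) three_plus_one \<longleftrightarrow> sorted g"
proof
  assume *: "lex_sorted int g \<and> \<not> poset_contains (code_rel g) three_plus_one"
  note g = codesD[OF assms]
  show "sorted g"
    unfolding sorted_iff_nth_mono_less
  proof (intro allI impI)
    fix i j assume ij: "i < j" "j < length g"
    show "g ! i \<le> g ! j"
    proof (rule ccontr)
      assume ng: "\<not> g ! i \<le> g ! j"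
      then have "cnt g i \<noteq> cnt g j" using * ij by (force simp: lex_sorted_def)
      then have "{k. k < n \<and> g ! k \<le> i} \<noteq> {k. k < n \<and> g ! k \<le> j}"
        unfolding cnt_card g(1) by metis
      moreover have "{k. k < n \<and> g ! k \<le> i} \<subseteq> {k. k < n \<and> g ! k \<le> j}"
        using ij(1) by auto
      ultimately obtain m where m: "m < n" "g ! m \<le> j" "\<not> g ! m \<le> i" by blast
      \<comment> \<open>Since \<open>g ! j < g ! i \<le> n\<close>, the value \<open>g ! j\<close>
        is itself an element, the first one above \<open>j\<close>.\<close>
      have lt: "i < n" "j < n" "g ! j < n" using ij ng g(1) g(3)[of i] by auto
      then have jm: "j < g ! j" "m < g ! m" using g(2) m by auto
      have "m \<noteq> i" "m \<noteq> j" using m jm ng by auto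
      then have "(m, j) \<in> code_rel g" "(j, g ! j) \<in> code_rel g"
        "(m, i) \<notin> code_rel g" "(i, g ! j) \<notin> code_rel g"
        using m lt ng ij(1) jm by (simp_all add: code_rel_iff[OF assms])
      moreover have "{m, j, g ! j, i} \<subseteq> {..<n}" using m lt by simp
      moreover have "j \<noteq> g ! j" using jm by simp
      ultimately have "poset_contains (code_rel g) three_plus_one"
        unfolding contains_31_iff[OF code_rel_labelled_poset[OF assms]]
        using \<open>m \<noteq> j\<close> by blast
      then show False using * by blast
    qed
  qed
qed (use assms code_rel_avoids_31 in \<open>auto simp: lex_sorted_def sorted_iff_nth_mono_less\<close>)

text \<open>Suppose \<open>i < j < g ! i < g ! j\<close>. The reversed tie-breaking rules out equal
  down-sets, so some \<open>m\<close> is below \<open>j\<close> but not below \<open>i\<close>, and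
  \<open>m\<close>, \<open>i\<close>, \<open>j\<close>, \<open>g ! i\<close> play the roles of
  \<open>a\<close>, \<open>b\<close>, \<open>c\<close>, \<open>d\<close> in
  \<open>N_poset\<close>.\<close>

lemma code_eq_laminar:
  assumes "g \<in> codes n"
  shows "lex_sorted (\<lambda>v. - int v) g \<and> \<not> poset_contains (code_rel g) N_poset \<longleftrightarrow> laminar g"
proof
  assume *: "lex_sorted (\<lambda>v. - int v) g \<and> \<not> poset_contains (code_rel g) N_poset"
  note g = codesD[OF assms]
  show "laminar g"
    unfolding laminar_def
  proof (intro allI impI)
    fix i j assume ij: "i < j" "j < length g" "j < g ! i"
    show "g ! j \<le> g ! i"
    proof (rule ccontr)
      assume ng: "\<not> g ! j \<le> g ! i"
      then have "cnt g i \<noteq> cnt g j" using * ij by (force simp: lex_sorted_def)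
      then have "{k. k < n \<and> g ! k \<le> i} \<noteq> {k. k < n \<and> g ! k \<le> j}"
        unfolding cnt_card g(1) by metis
      moreover have "{k. k < n \<and> g ! k \<le> i} \<subseteq> {k. k < n \<and> g ! k \<le> j}"
        using ij(1) by auto
      ultimately obtain m where m: "m < n" "g ! m \<le> j" "\<not> g ! m \<le> i" by blast
      have lt: "i < n" "j < n" "g ! i < n" using ij ng g(1) g(3)[of j] by auto
      have "m < g ! m" using g(2) m by auto
      then have "m \<noteq> i" using m ij(3) by auto
      then have "(m, j) \<in> code_rel g" "(m, g ! i) \<in> code_rel g" "(i, g ! i) \<in> code_rel g"
        "(i, j) \<notin> code_rel g" "(j, g ! i) \<notin> code_rel g" "(m, i) \<notin> code_rel g"
        using m lt ng ij by (simp_all add: code_rel_iff[OF assms])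
      moreover have "{m, i, j, g ! i} \<subseteq> {..<n}" using m lt by simp
      ultimately have "poset_contains (code_rel g) N_poset"
        unfolding contains_N_iff[OF code_rel_labelled_poset[OF assms]] by blast
      then show False using * by blast
    qed
  qed
next
  assume lam: "laminar g"
  note g = codesD[OF assms]
  have "- int (g ! i) \<le> - int (g ! j)" if "i < j" "j < n" "cnt g i = cnt g j" for i j
  proof -
    \<comment> \<open>Equal counts mean that no entry lies in the range from \<open>i + 1\<close> to
      \<open>j\<close>. Applied to the entry \<open>g ! i\<close> this gives
      \<open>j < g ! i\<close>, so laminarity compares the two entries.\<close>
    have "{k. k < n \<and> g ! k \<le> i} = {k. k < n \<and> g ! k \<le> j}"
      using that by (intro card_subset_eq) (auto simp: cnt_card g(1))
    then have "i \<in> {k. k < n \<and> g ! k \<le> i} \<longleftrightarrow> i \<in> {k. k < n \<and> g ! k \<le> j}"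
      by (simp only:)
    then have "j < g ! i" using that g(2)[of i] by simp
    then show ?thesis using lam that g(1) by (auto simp: laminar_def)
  qed
  then show "lex_sorted (\<lambda>v. - int v) g \<and> \<not> poset_contains (code_rel g) N_poset"
    using code_rel_avoids_N[OF assms lam] g(1) by (auto simp: lex_sorted_def)
qed

subsection \<open>Width and rearrangements\<close>

lemma antichain_code_rel_iff:
  assumes "g \<in> codes n"
  shows "antichain (code_rel g) A \<longleftrightarrow> A \<subseteq> {..<n} \<and> (\<forall>i\<in>A. \<forall>j\<in>A. i < j \<longrightarrow> j < g ! i)"
proof -
  have "((i, j) \<in> code_rel g \<longrightarrow> i = j) \<longleftrightarrow> (i < j \<longrightarrow> j < g ! i)" if "i < n" "j < n" for i j
    using codesD(2)[OF assms that(1)] code_rel_iff[OF assms that] by auto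
  then show ?thesis
    unfolding antichain_def Field_labelled_poset[OF code_rel_labelled_poset[OF assms]]
    by (meson lessThan_iff subsetD)
qed

text \<open>Widths are compared through their upper bounds: two naturals with the same upper bounds
  are equal.\<close>

lemma width_le_iff:
  assumes "g \<in> codes n"
  shows "width (code_rel g) \<le> w \<longleftrightarrow> (\<forall>A. antichain (code_rel g) A \<longrightarrow> card A \<le> w)"
proof -
  have "{A. antichain (code_rel g) A} \<subseteq> Pow {..<n}"
    by (auto simp: antichain_code_rel_iff[OF assms])
  then have "finite {A. antichain (code_rel g) A}"
    by (rule finite_subset) simp
  moreover have "antichain (code_rel g) {}" by (simp add: antichain_def)
  ultimately show ?thesis unfolding width_def by (subst Max_le_iff) auto
qed

text \<open>Pairwise overlapping intervals share a point, so the width is the largest number of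
  intervals over a point \<open>t\<close>. This number is \<open>Suc t - cnt g t\<close>, which
  depends only on the multiset of entries.\<close>

lemma width_le_iff_cnt:
  assumes "g \<in> codes n"
  shows "width (code_rel g) \<le> w \<longleftrightarrow> (\<forall>t<n. Suc t \<le> w + cnt g t)"
proof -
  note g = codesD[OF assms]
  define V where "V t = {i. i \<le> t \<and> t < g ! i}" for t
  have fin: "finite (V t)" for t
    by (rule finite_subset[of _ "{..t}"]) (auto simp: V_def)
  have card_V: "Suc t = card (V t) + cnt g t" if "t < n" for t
  proof -
    \<comment> \<open>An interval that has ended by \<open>t\<close> has also started by
      \<open>t\<close>.\<close>
    have "{..t} = V t \<union> {k. k < n \<and> g ! k \<le> t}"
      using that g(2) by (fastforce simp: V_def)
    then have "card {..t} = card (V t \<union> {k. k < n \<and> g ! k \<le> t})" by (rule arg_cong)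
    also have "\<dots> = card (V t) + cnt g t"
      unfolding cnt_card g(1) by (rule card_Un_disjoint) (use fin in \<open>auto simp: V_def\<close>)
    finally show ?thesis by simp
  qed
  have "(\<forall>A. antichain (code_rel g) A \<longrightarrow> card A \<le> w) \<longleftrightarrow> (\<forall>t<n. card (V t) \<le> w)"
  proof (intro iffI allI impI)
    fix t assume "\<forall>A. antichain (code_rel g) A \<longrightarrow> card A \<le> w" and t: "t < n"
    moreover have "antichain (code_rel g) (V t)"
      unfolding antichain_code_rel_iff[OF assms] using t by (auto simp: V_def)
    ultimately show "card (V t) \<le> w" by blast
  next
    fix A assume *: "\<forall>t<n. card (V t) \<le> w" and "antichain (code_rel g) A"
    then have A: "A \<subseteq> {..<n}" "\<And>i j. i \<in> A \<Longrightarrow> j \<in> A \<Longrightarrow> i < j \<Longrightarrow> j < g ! i"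
      by (auto simp: antichain_code_rel_iff[OF assms])
    have finA: "finite A" using A(1) by (rule finite_subset) simp
    show "card A \<le> w"
    proof (cases "A = {}")
      case False
      \<comment> \<open>The last left endpoint is a common point: every other member starts earlier
        and must overlap the last one.\<close>
      define t where "t = Max A"
      have t: "t \<in> A" "\<And>i. i \<in> A \<Longrightarrow> i \<le> t"
        using finA False by (auto simp: t_def)
      have "t < n" using t(1) A(1) by auto
      have "A \<subseteq> V t"
        using t A(2)[OF _ t(1)] g(2)[OF \<open>t < n\<close>] by (force simp: V_def le_less)
      then have "card A \<le> card (V t)" by (rule card_mono[OF fin])
      then show ?thesis using * \<open>t < n\<close> by force
    qed simp
  qed
  also have "\<dots> \<longleftrightarrow> (\<forall>t<n. Suc t \<le> w + cnt g t)"
    using card_V by auto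
  finally show ?thesis using width_le_iff[OF assms] by simp
qed

text \<open>For increasing \<open>g\<close>, the set \<open>{i..<g ! i}\<close> is an antichain, and
  it contains every antichain with least element \<open>i\<close>. Thus the width is the maximum of
  \<open>g ! i - i\<close>.\<close>

lemma width_le_iff_sorted:
  assumes "g \<in> codes n" "sorted g"
  shows "width (code_rel g) \<le> w \<longleftrightarrow> (\<forall>i<n. g ! i \<le> w + i)"
proof -
  note g = codesD[OF assms(1)]
  have mono: "g ! i \<le> g ! j" if "i \<le> j" "j < n" for i j
    using assms(2) that g(1) by (simp add: sorted_nth_mono)
  have "(\<forall>A. antichain (code_rel g) A \<longrightarrow> card A \<le> w) \<longleftrightarrow> (\<forall>i<n. card {i..<g ! i} \<le> w)"
  proof (intro iffI allI impI)
    fix i assume *: "\<forall>A. antichain (code_rel g) A \<longrightarrow> card A \<le> w" "i < n"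
    then have "antichain (code_rel g) {i..<g ! i}"
      unfolding antichain_code_rel_iff[OF assms(1)]
      using g(3)[of i] mono[of i] by (fastforce intro: less_le_trans)
    then show "card {i..<g ! i} \<le> w" using * by blast
  next
    fix A assume *: "\<forall>i<n. card {i..<g ! i} \<le> w" and "antichain (code_rel g) A"
    then have A: "A \<subseteq> {..<n}" "\<And>i j. i \<in> A \<Longrightarrow> j \<in> A \<Longrightarrow> i < j \<Longrightarrow> j < g ! i"
      by (auto simp: antichain_code_rel_iff[OF assms(1)])
    have finA: "finite A" using A(1) by (rule finite_subset) simp
    show "card A \<le> w"
    proof (cases "A = {}")
      case False
      define i where "i = Min A"
      have i: "i \<in> A" "\<And>j. j \<in> A \<Longrightarrow> i \<le> j"
        using finA False by (auto simp: i_def)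
      have "i < n" using i(1) A(1) by auto
      have "A \<subseteq> {i..<g ! i}"
        using i A(2)[OF i(1)] g(2)[OF \<open>i < n\<close>] by (force simp: le_less)
      then have "card A \<le> card {i..<g ! i}" by (rule card_mono[rotated]) simp
      then show ?thesis using * \<open>i < n\<close> by force
    qed simp
  qed
  also have "\<dots> \<longleftrightarrow> (\<forall>i<n. g ! i \<le> w + i)" by auto
  finally show ?thesis using width_le_iff[OF assms(1)] by simp
qed

section \<open>Sorted and laminar rearrangements of a code\<close>

lemma cnt_mset: "mset g = mset g' \<Longrightarrow> cnt g t = cnt g' t"
  unfolding cnt_def by (metis mset_filter size_mset)

lemma width_code_rel_mset:
  assumes "g \<in> codes n" "g' \<in> codes n" "mset g = mset g'"
  shows "width (code_rel g) = width (code_rel g')"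
  using width_le_iff_cnt[OF assms(1)] width_le_iff_cnt[OF assms(2)] cnt_mset[OF assms(3)]
  by (metis le_antisym order_refl)

text \<open>If the sorted list had an entry at most \<open>i\<close> at position \<open>i\<close>,
  then at least \<open>i + 1\<close> entries would be at most \<open>i\<close>. In the original code
  such entries occur only at positions below \<open>i\<close>.\<close>

lemma sort_in_codes:
  assumes "g \<in> codes n"
  shows "sort g \<in> codes n"
proof -
  note g = codesD[OF assms]
  have len: "length (sort g) = n" by (simp add: g(1))
  have "i < sort g ! i" if i: "i < n" for i
  proof (rule ccontr)
    assume "\<not> i < sort g ! i"
    moreover have "sort g ! k \<le> sort g ! i" if "k \<le> i" for k
      using that i len by (simp add: sorted_nth_mono)
    ultimately have "{..i} \<subseteq> {k. k < n \<and> sort g ! k \<le> i}"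
      using i by fastforce
    then have "card {..i} \<le> card {k. k < n \<and> sort g ! k \<le> i}"
      by (rule card_mono[rotated]) simp
    also have "\<dots> = cnt g i"
      using cnt_mset[of "sort g" g i] cnt_card[of "sort g" i] by (simp add: g(1))
    also have "\<dots> \<le> card {..<i}"
      unfolding cnt_card using g by (intro card_mono) (auto intro: less_le_trans)
    finally show False by simp
  qed
  moreover have "sort g ! i \<le> n" if "i < n" for i
  proof -
    have "sort g ! i \<in> set g" using that len nth_mem[of i "sort g"] by simp
    then obtain k where "k < n" "sort g ! i = g ! k" using g(1) by (auto simp: in_set_conv_nth)
    then show ?thesis using g(3) by simp
  qed
  ultimately show ?thesis using len by (simp add: codes_def)
qed

text \<open>The first \<open>i + 1\<close> entries of the two codes agree as multisets, so
  \<open>g ! i\<close> occurs in \<open>g'\<close> at some \<open>j \<le> i\<close>. If it were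
  smaller than \<open>g' ! i\<close>, then \<open>j < i < g' ! j\<close>, and laminarity would give
  \<open>g' ! i \<le> g' ! j = g ! i\<close>.\<close>

lemma laminar_code_last_difference:
  assumes g: "g \<in> codes n" and g': "g' \<in> codes n" "laminar g'" and eq: "mset g = mset g'"
    and i: "i < n" "\<And>k. i < k \<Longrightarrow> k < n \<Longrightarrow> g ! k = g' ! k"
  shows "g' ! i \<le> g ! i"
proof (rule ccontr)
  assume less: "\<not> g' ! i \<le> g ! i"
  have len: "length g = n" "length g' = n" using g g' by (auto simp: codes_def)
  have "drop (Suc i) g = drop (Suc i) g'"
    by (rule nth_equalityI) (use len i in auto)
  moreover have "mset (take (Suc i) g) + mset (drop (Suc i) g) =
      mset (take (Suc i) g') + mset (drop (Suc i) g')"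
    using eq by (simp only: append_take_drop_id flip: mset_append)
  ultimately have "mset (take (Suc i) g) = mset (take (Suc i) g')"
    by simp
  then have "set (take (Suc i) g) = set (take (Suc i) g')"
    by (rule mset_eq_setD)
  moreover have "g ! i \<in> set (take (Suc i) g)"
    using i(1) len by (auto simp: in_set_conv_nth intro!: exI[of _ i])
  ultimately obtain j where j: "j \<le> i" "g' ! j = g ! i"
    by (auto simp: in_set_conv_nth less_Suc_eq_le)
  then have "j < i" using less by (auto simp: le_less)
  moreover have "i < g' ! j" using j codesD(2)[OF g i(1)] by simp
  ultimately have "g' ! i \<le> g' ! j" using g'(2) i len by (simp add: laminar_def)
  then show False using j less by simp
qed

lemma laminar_code_unique:
  assumes "g \<in> codes n" "laminar g" "g' \<in> codes n" "laminar g'" "mset g = mset g'"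
  shows "g = g'"
proof (rule ccontr)
  assume "g \<noteq> g'"
  have len: "length g = n" "length g' = n" using assms by (auto simp: codes_def)
  define X where "X = {i. i < n \<and> g ! i \<noteq> g' ! i}"
  have X: "finite X" "X \<noteq> {}"
    using \<open>g \<noteq> g'\<close> len by (auto simp: X_def list_eq_iff_nth_eq)
  define i where "i = Max X"
  have "i \<in> X" using X by (simp add: i_def)
  then have i: "i < n" "g ! i \<noteq> g' ! i" by (auto simp: X_def)
  have eq: "g ! k = g' ! k" if "i < k" "k < n" for k
  proof (rule ccontr)
    assume "g ! k \<noteq> g' ! k"
    then have "k \<le> i" unfolding i_def using X(1) that by (intro Max_ge) (auto simp: X_def)
    then show False using that by simp
  qed
  \<comment> \<open>At the last position where the codes differ, the preceding bound applies in both
    directions.\<close>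
  have "g' ! i \<le> g ! i"
    by (rule laminar_code_last_difference[OF assms(1,3,4,5) i(1) eq])
  moreover have "g ! i \<le> g' ! i"
    by (rule laminar_code_last_difference[OF assms(3,1,2) assms(5)[symmetric] i(1)])
       (simp add: eq)
  ultimately show False using i by simp
qed

text \<open>Exchanging two values that violate laminarity decreases $\sum_i i\,g_i$, so a minimizer of
  this sum is laminar.\<close>

lemma ex_laminar_rearrangement:
  assumes "f \<in> codes n"
  obtains g where "g \<in> codes n" "laminar g" "mset g = mset f"
proof -
  define S where "S = {g \<in> codes n. mset g = mset f}"
  define m where "m g = (\<Sum>i<n. i * g ! i)" for g :: "nat list"
  have "f \<in> S" using assms by (simp add: S_def)
  then obtain g where g: "g \<in> S" "\<And>g'. g' \<in> S \<Longrightarrow> m g \<le> m g'"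
    using ex_has_least_nat[of "\<lambda>g. g \<in> S" f m] by blast
  then have code: "g \<in> codes n" and ms: "mset g = mset f" by (auto simp: S_def)
  note gc = codesD[OF code]
  have "laminar g"
    unfolding laminar_def
  proof (intro allI impI)
    fix i j assume ij: "i < j" "j < length g" "j < g ! i"
    show "g ! j \<le> g ! i"
    proof (rule ccontr)
      assume less: "\<not> g ! j \<le> g ! i"
      have lt: "i < n" "j < n" using ij gc(1) by auto
      define h where "h = g[i := g ! j, j := g ! i]"
      have h_nth: "h ! i = g ! j" "h ! j = g ! i" "\<And>k. k \<noteq> i \<Longrightarrow> k \<noteq> j \<Longrightarrow> h ! k = g ! k"
        using lt ij gc(1) by (auto simp: h_def)
      have "mset h = mset g"
        unfolding h_def using lt gc(1) by (intro mset_swap) auto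
      moreover have "h \<in> codes n"
        unfolding codes_def
      proof (intro CollectI conjI allI impI)
        fix k assume k: "k < n"
        \<comment> \<open>Position \<open>i\<close> receives the larger entry; at position
          \<open>j\<close> the requirement is the assumption \<open>j < g ! i\<close>.\<close>
        show "k < h ! k"
          using gc(2)[OF k] ij(1,3) less h_nth by (cases "k = i"; cases "k = j") auto
        show "h ! k \<le> n"
          using gc(3)[OF k] gc(3) lt h_nth by (cases "k = i"; cases "k = j") auto
      qed (simp add: h_def gc(1))
      ultimately have "m g \<le> m h" using ms g(2) by (simp add: S_def)
      moreover have split: "m x = i * x ! i + (j * x ! j + (\<Sum>k\<in>{..<n} - {i} - {j}. k * x ! k))"
        for x
        unfolding m_def using lt ij(1) by (simp add: sum.remove[of _ i] sum.remove[of _ j])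
      moreover have "(\<Sum>k\<in>{..<n} - {i} - {j}. k * h ! k) = (\<Sum>k\<in>{..<n} - {i} - {j}. k * g ! k)"
        by (rule sum.cong) (auto simp: h_nth)
      ultimately have "i * g ! i + j * g ! j \<le> i * g ! j + j * g ! i"
        by (simp add: h_nth)
      \<comment> \<open>Minimality says that the product of \<open>j - i\<close> and
        \<open>g ! j - g ! i\<close> is not positive; \<open>Suc p\<close> and \<open>Suc q\<close>
        are these two differences.\<close>
      moreover obtain p q where "j = i + Suc p" "g ! j = g ! i + Suc q"
        using ij(1) less by (metis less_imp_Suc_add add_Suc_right not_le)
      ultimately show False by (simp add: algebra_simps)
    qed
  qed
  with code ms that show thesis by blast
qed

text \<open>Injectivity is the uniqueness of the laminar arrangement of a multiset of entries,
  surjectivity its existence.\<close>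

lemma bij_betw_sort_laminar:
  "bij_betw sort {g \<in> codes n. laminar g} {g \<in> codes n. sorted g}"
proof (rule bij_betwI')
  fix g g' assume "g \<in> {g \<in> codes n. laminar g}" "g' \<in> {g \<in> codes n. laminar g}"
  then show "sort g = sort g' \<longleftrightarrow> g = g'"
    using laminar_code_unique by (metis (mono_tags, lifting) mem_Collect_eq mset_sort)
next
  fix f assume "f \<in> {g \<in> codes n. sorted g}"
  then obtain g where "g \<in> codes n" "laminar g" "mset g = mset f" "sorted f"
    using ex_laminar_rearrangement by blast
  then show "\<exists>g\<in>{g \<in> codes n. laminar g}. f = sort g"
    using properties_for_sort[of f g] by auto
qed (use sort_in_codes in auto)

subsection \<open>Dyck paths\<close>

text \<open>The parameter \<open>u\<close> is the number of up steps already taken.\<close>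

primrec downs :: "nat \<Rightarrow> int list \<Rightarrow> nat list" where
  "downs u [] = []"
| "downs u (x # xs) = (if x = 1 then downs (Suc u) xs else u # downs u xs)"

text \<open>Inverse of \<open>downs\<close> on increasing lists; the final block of up steps raises
  their total to \<open>n\<close>.\<close>

primrec path_of :: "nat \<Rightarrow> nat \<Rightarrow> nat list \<Rightarrow> int list" where
  "path_of n u [] = replicate (n - u) 1"
| "path_of n u (v # vs) = replicate (v - u) 1 @ -1 # path_of n v vs"

lemma length_downs:
  "set xs \<subseteq> {1, -1} \<Longrightarrow> 2 * int (length (downs u xs)) + sum_list xs = int (length xs)"
  by (induction xs arbitrary: u) auto

text \<open>The second bound says that \<open>v\<close> is at most \<open>u\<close> plus the number
  of up steps in \<open>xs\<close>, written without subtraction.\<close>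

lemma downs_bounds:
  "v \<in> set (downs u xs) \<Longrightarrow> u \<le> v \<and> v + length (downs u xs) \<le> u + length xs"
proof (induction xs arbitrary: u)
  case (Cons x xs)
  have "length (downs u xs) \<le> length xs" for u
    by (induction xs arbitrary: u) (auto intro: le_SucI)
  then show ?case using Cons.IH Cons.prems by (fastforce split: if_splits)
qed simp

lemma sorted_downs: "sorted (downs u xs)"
  by (induction xs arbitrary: u) (auto dest: downs_bounds)

lemma all_le_length_Cons:
  "(\<forall>k\<le>length (x # xs). P k) \<longleftrightarrow> P 0 \<and> (\<forall>k\<le>length xs. P (Suc k))"
  by (auto simp: All_less_Suc2 simp flip: less_Suc_eq_le)

lemma all_less_length_Cons:
  "(\<forall>k<length (x # xs). P k) \<longleftrightarrow> P 0 \<and> (\<forall>k<length xs. P (Suc k))"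
  by (simp add: All_less_Suc2)

text \<open>Here \<open>d\<close> counts the down steps already taken, so that \<open>u - d\<close> is the current height.\<close>

lemma nonneg_prefix_sums_iff_downs:
  assumes "set xs \<subseteq> {1, -1}"
  shows "(\<forall>k\<le>length xs. 0 \<le> int u - int d + sum_list (take k xs)) \<longleftrightarrow>
    d \<le> u \<and> (\<forall>i<length (downs u xs). d + i < downs u xs ! i)"
  using assms
proof (induction xs arbitrary: u d)
  case (Cons x xs)
  show ?case
  proof (cases "x = 1")
    case True
    have "(\<forall>k\<le>length (x # xs). 0 \<le> int u - int d + sum_list (take k (x # xs))) \<longleftrightarrow>
      d \<le> u \<and> (\<forall>k\<le>length xs. 0 \<le> int (Suc u) - int d + sum_list (take k xs))"
      unfolding all_le_length_Cons using True by (simp add: algebra_simps)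
    also have "\<dots> \<longleftrightarrow> d \<le> u \<and> d \<le> Suc u \<and>
      (\<forall>i<length (downs (Suc u) xs). d + i < downs (Suc u) xs ! i)"
      using Cons.IH[of "Suc u" d] Cons.prems by simp
    finally show ?thesis using True by auto
  next
    case False
    then have x: "x = -1" using Cons.prems by auto
    have "(\<forall>k\<le>length (x # xs). 0 \<le> int u - int d + sum_list (take k (x # xs))) \<longleftrightarrow>
      d \<le> u \<and> (\<forall>k\<le>length xs. 0 \<le> int u - int (Suc d) + sum_list (take k xs))"
      unfolding all_le_length_Cons using x by (simp add: algebra_simps)
    also have "\<dots> \<longleftrightarrow> d < u \<and> (\<forall>i<length (downs u xs). Suc d + i < downs u xs ! i)"
      using Cons.IH[of u "Suc d"] Cons.prems by auto
    also have "\<dots> \<longleftrightarrow> d \<le> u \<and> (\<forall>i<length (u # downs u xs). d + i < (u # downs u xs) ! i)"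
      unfolding all_less_length_Cons by auto
    finally show ?thesis using x by simp
  qed
qed simp

text \<open>Between down steps the path only rises, so its maximum is attained just before a down
  step or at the end, where the height is 0. Just before the down step with index \<open>i\<close>
  the height is \<open>downs u xs ! i - (d + i)\<close>.\<close>

lemma prefix_sums_le_iff_downs:
  assumes "set xs \<subseteq> {1, -1}" "int u - int d + sum_list xs = 0"
  shows "(\<forall>k\<le>length xs. int u - int d + sum_list (take k xs) \<le> int w) \<longleftrightarrow>
    (\<forall>i<length (downs u xs). downs u xs ! i \<le> w + (d + i))"
  using assms
proof (induction xs arbitrary: u d)
  case (Cons x xs)
  show ?case
  proof (cases "x = 1")
    case True
    have "(\<forall>k\<le>length (x # xs). int u - int d + sum_list (take k (x # xs)) \<le> int w) \<longleftrightarrow>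
      int u - int d \<le> int w \<and>
      (\<forall>k\<le>length xs. int (Suc u) - int d + sum_list (take k xs) \<le> int w)"
      unfolding all_le_length_Cons using True by (simp add: algebra_simps)
    \<comment> \<open>The bound at the start follows from the bound after the up step, which is the
      case \<open>k = 0\<close>.\<close>
    also have "\<dots> \<longleftrightarrow> (\<forall>k\<le>length xs. int (Suc u) - int d + sum_list (take k xs) \<le> int w)"
      by (auto dest: spec[of _ 0])
    also have "\<dots> \<longleftrightarrow>
      (\<forall>i<length (downs (Suc u) xs). downs (Suc u) xs ! i \<le> w + (d + i))"
      by (rule Cons.IH) (use Cons.prems True in auto)
    finally show ?thesis using True by simp
  next
    case False
    then have x: "x = -1" using Cons.prems by auto
    have "(\<forall>k\<le>length (x # xs). int u - int d + sum_list (take k (x # xs)) \<le> int w) \<longleftrightarrow>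
      u \<le> w + d \<and> (\<forall>k\<le>length xs. int u - int (Suc d) + sum_list (take k xs) \<le> int w)"
      unfolding all_le_length_Cons using x by (auto simp: algebra_simps)
    also have "\<dots> \<longleftrightarrow> u \<le> w + d \<and> (\<forall>i<length (downs u xs). downs u xs ! i \<le> w + (Suc d + i))"
      using Cons.IH[of u "Suc d"] Cons.prems x by simp
    also have "\<dots> \<longleftrightarrow> (\<forall>i<length (u # downs u xs). (u # downs u xs) ! i \<le> w + (d + i))"
      unfolding all_less_length_Cons by simp
    finally show ?thesis using x by simp
  qed
qed simp

text \<open>A down step at the front emits \<open>u\<close>, whereas after an up step all emitted
  values exceed \<open>u\<close>, so the first step can be read off. Trailing up steps leave no
  trace; equality of lengths accounts for them.\<close>

lemma downs_inject:
  assumes "set xs \<subseteq> {1, -1}" "set ys \<subseteq> {1, -1}" "length xs = length ys" "downs u xs = downs u ys"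
  shows "xs = ys"
  using assms
proof (induction xs arbitrary: u ys)
  case (Cons x xs)
  then obtain y zs where ys: "ys = y # zs" by (cases ys) auto
  have no: "downs (Suc u) zs \<noteq> u # vs" for zs vs
    using downs_bounds[of u "Suc u" zs] by auto
  from Cons.prems(4) have "(x = 1) = (y = 1)"
    using no[of xs "downs u zs"] no[of zs "downs u xs"] by (auto simp: ys split: if_splits)
  then have "x = y" using Cons.prems ys by auto
  moreover have "xs = zs"
    using Cons.IH[of zs] Cons.prems ys \<open>x = y\<close> by (auto split: if_splits)
  ultimately show ?case by (simp add: ys)
qed simp

lemma downs_replicate_append: "downs u (replicate k 1 @ xs) = downs (u + k) xs"
  by (induction k arbitrary: u) auto

lemma downs_path_of:
  "sorted (u # vs) \<Longrightarrow> downs u (path_of n u vs) = vs"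
proof (induction vs arbitrary: u)
  case Nil
  then show ?case using downs_replicate_append[of u "n - u" "[]"] by simp
qed (auto simp: downs_replicate_append)

lemma length_path_of:
  "sorted (u # vs) \<Longrightarrow> u \<le> n \<Longrightarrow> \<forall>v\<in>set vs. v \<le> n \<Longrightarrow>
     length (path_of n u vs) = n - u + length vs"
  by (induction vs arbitrary: u) auto

lemma set_path_of: "set (path_of n u vs) \<subseteq> {1, -1}"
  by (induction vs arbitrary: u) auto

lemma downs_in_codes_iff:
  assumes "set \<mu> \<subseteq> {1, -1}" "length \<mu> = 2 * n" "sum_list \<mu> = 0"
  shows "downs 0 \<mu> \<in> codes n \<longleftrightarrow> \<mu> \<in> dyck_paths n"
proof -
  have len: "length (downs 0 \<mu>) = n"
    using length_downs[OF assms(1), of 0] assms by simp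
  have "downs 0 \<mu> ! i \<le> n" if "i < n" for i
    using downs_bounds[of "downs 0 \<mu> ! i" 0 \<mu>] that len assms(2) by simp
  then show ?thesis
    using nonneg_prefix_sums_iff_downs[OF assms(1), of 0 0] len assms
    by (auto simp: codes_def dyck_paths_def)
qed

lemma bij_betw_downs: "bij_betw (downs 0) (dyck_paths n) {g \<in> codes n. sorted g}"
proof (rule bij_betwI')
  fix \<mu> \<nu> assume "\<mu> \<in> dyck_paths n" "\<nu> \<in> dyck_paths n"
  then show "downs 0 \<mu> = downs 0 \<nu> \<longleftrightarrow> \<mu> = \<nu>"
    using downs_inject by (auto simp: dyck_paths_def)
next
  fix \<mu> assume "\<mu> \<in> dyck_paths n"
  then show "downs 0 \<mu> \<in> {g \<in> codes n. sorted g}"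
    using downs_in_codes_iff[of \<mu> n] sorted_downs by (auto simp: dyck_paths_def)
next
  fix g assume "g \<in> {g \<in> codes n. sorted g}"
  then have g: "g \<in> codes n" "sorted (0 # g)" by auto
  note gc = codesD[OF g(1)]
  define \<mu> where "\<mu> = path_of n 0 g"
  have d: "downs 0 \<mu> = g" unfolding \<mu>_def by (rule downs_path_of[OF g(2)])
  have set: "set \<mu> \<subseteq> {1, -1}" unfolding \<mu>_def by (rule set_path_of)
  have len: "length \<mu> = 2 * n"
  proof -
    have "\<forall>v\<in>set g. v \<le> n" using gc(1,3) by (auto simp: in_set_conv_nth)
    then show ?thesis unfolding \<mu>_def using length_path_of[OF g(2), of n] gc(1) by simp
  qed
  have "sum_list \<mu> = 0"
    using length_downs[OF set, of 0] len d gc(1) by simp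
  then have "\<mu> \<in> dyck_paths n" using downs_in_codes_iff[OF set len] d g(1) by simp
  then show "\<exists>\<mu>\<in>dyck_paths n. g = downs 0 \<mu>" using d by blast
qed

lemma height_le_iff: "height \<mu> \<le> w \<longleftrightarrow> (\<forall>k\<le>length \<mu>. sum_list (take k \<mu>) \<le> int w)"
proof -
  have "height \<mu> \<le> w \<longleftrightarrow> Max ((\<lambda>k. sum_list (take k \<mu>)) ` {..length \<mu>}) \<le> int w"
    by (simp add: height_def nat_le_iff)
  also have "\<dots> \<longleftrightarrow> (\<forall>k\<le>length \<mu>. sum_list (take k \<mu>) \<le> int w)"
    by (subst Max_le_iff) auto
  finally show ?thesis .
qed

text \<open>With \<open>g\<close> for \<open>downs 0 \<mu>\<close>, both numbers are bounded by
  \<open>w\<close> exactly when \<open>g ! i \<le> w + i\<close> for all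
  \<open>i < n\<close>.\<close>

lemma width_downs:
  assumes "\<mu> \<in> dyck_paths n"
  shows "width (code_rel (downs 0 \<mu>)) = height \<mu>"
proof -
  have code: "downs 0 \<mu> \<in> codes n" "sorted (downs 0 \<mu>)"
    using bij_betwE[OF bij_betw_downs] assms by auto
  have "width (code_rel (downs 0 \<mu>)) \<le> w \<longleftrightarrow> height \<mu> \<le> w" for w
    unfolding width_le_iff_sorted[OF code] height_le_iff
    using prefix_sums_le_iff_downs[of \<mu> 0 0 w] assms codesD(1)[OF code(1)]
    by (simp add: dyck_paths_def)
  then show ?thesis by (metis le_antisym order_refl)
qed

section \<open>From posets to Dyck paths\<close>

lemma sum_posets_avoiding_31:
  "(\<Sum>C\<in>posets_avoiding_22_and n three_plus_one. F (class_width C)) =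
     (\<Sum>\<mu>\<in>dyck_paths n. F (height \<mu>))"
proof -
  have "(\<Sum>C\<in>posets_avoiding_22_and n three_plus_one. F (class_width C)) =
      (\<Sum>g | g \<in> codes n \<and> sorted g. F (width (code_rel g)))"
    unfolding sum_posets_avoiding[OF inj_of_nat]
    by (rule sum.cong) (use code_eq_sorted in auto)
  also have "\<dots> = (\<Sum>\<mu>\<in>dyck_paths n. F (width (code_rel (downs 0 \<mu>))))"
    by (rule sum.reindex_bij_betw[OF bij_betw_downs, symmetric])
  finally show ?thesis by (simp add: width_downs)
qed

text \<open>Sorting turns laminar codes into increasing ones and keeps the width, which reduces this
  sum to the one already identified with Dyck paths.\<close>

lemma sum_posets_avoiding_N:
  "(\<Sum>C\<in>posets_avoiding_22_and n N_poset. F (class_width C)) =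
     (\<Sum>\<mu>\<in>dyck_paths n. F (height \<mu>))"
proof -
  have inj: "inj (\<lambda>v. - int v)" by (auto simp: inj_def)
  have "(\<Sum>C\<in>posets_avoiding_22_and n N_poset. F (class_width C)) =
      (\<Sum>g | g \<in> codes n \<and> laminar g. F (width (code_rel g)))"
    unfolding sum_posets_avoiding[OF inj]
    by (rule sum.cong) (use code_eq_laminar in auto)
  also have "\<dots> = (\<Sum>g | g \<in> codes n \<and> laminar g. F (width (code_rel (sort g))))"
  proof (rule sum.cong[OF refl])
    fix g assume "g \<in> {g. g \<in> codes n \<and> laminar g}"
    then have "width (code_rel g) = width (code_rel (sort g))"
      using sort_in_codes by (intro width_code_rel_mset[of _ n]) auto
    then show "F (width (code_rel g)) = F (width (code_rel (sort g)))" by simp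
  qed
  also have "\<dots> = (\<Sum>g | g \<in> codes n \<and> sorted g. F (width (code_rel g)))"
    by (rule sum.reindex_bij_betw[OF bij_betw_sort_laminar])
  also have "\<dots> = (\<Sum>\<mu>\<in>dyck_paths n. F (width (code_rel (downs 0 \<mu>))))"
    by (rule sum.reindex_bij_betw[OF bij_betw_downs, symmetric])
  finally show ?thesis by (simp add: width_downs)
qed

subsection \<open>Nonnesting matchings\<close>

definition nonnesting :: "nat set set \<Rightarrow> bool" where
  "nonnesting M \<longleftrightarrow>
     \<not> (\<exists>a b c d. (a, b) \<in> arcs M \<and> (c, d) \<in> arcs M \<and> a < c \<and> d < b)"

lemma arcs_less: "(a, b) \<in> arcs M \<Longrightarrow> a < b"
  by (simp add: arcs_def)

lemma arcs_bounds:
  assumes "matching n M" "(a, b) \<in> arcs M"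
  shows "a \<in> {1..2 * n}" "b \<in> {1..2 * n}"
proof -
  have "\<Union>M = {1..2 * n}" "{a, b} \<in> M"
    using assms by (auto simp: matching_def partition_on_def arcs_def)
  then show "a \<in> {1..2 * n}" "b \<in> {1..2 * n}" by blast+
qed

lemma arcs_eqI:
  assumes "matching n M" "(a, b) \<in> arcs M" "(c, d) \<in> arcs M" "{a, b} \<inter> {c, d} \<noteq> {}"
  shows "(a, b) = (c, d)"
proof -
  have "disjoint M" "{a, b} \<in> M" "{c, d} \<in> M" "a < b" "c < d"
    using assms by (auto simp: matching_def partition_on_def arcs_def)
  then have "{a, b} = {c, d}"
    using assms(4) by (meson disjointD)
  then show ?thesis using \<open>a < b\<close> \<open>c < d\<close> by (auto simp: doubleton_eq_iff)
qed

lemma block_arc: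
  assumes "matching n M" "B \<in> M" "a \<in> B" "b \<in> B" "a < b"
  shows "B = {a, b}" "(a, b) \<in> arcs M"
proof -
  have "card B = 2" using assms by (auto simp: matching_def)
  then show "B = {a, b}" using assms(3-5) by (auto simp: card_2_iff)
  then show "(a, b) \<in> arcs M" using assms by (simp add: arcs_def)
qed

lemma arc_cases:
  assumes "matching n M" "p \<in> {1..2 * n}"
  obtains q where "(p, q) \<in> arcs M" | q where "(q, p) \<in> arcs M"
proof -
  have "p \<in> \<Union>M" using assms by (simp add: matching_def partition_on_def)
  then obtain B where B: "B \<in> M" "p \<in> B" by blast
  then obtain q where "q \<in> B" "q \<noteq> p"
    using assms(1) by (auto simp: matching_def card_2_iff)
  then show thesis
    using block_arc(2)[OF assms(1) B(1)] B(2) that by (cases p q rule: linorder_cases) auto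
qed

lemma matching_eq_arcs:
  assumes "matching n M"
  shows "M = (\<lambda>(a, b). {a, b}) ` arcs M"
proof (intro equalityI subsetI)
  fix B assume B: "B \<in> M"
  then have "card B = 2" using assms by (simp add: matching_def)
  then obtain x y where xy: "B = {x, y}" "x \<noteq> y" by (auto simp: card_2_iff)
  then have "(min x y, max x y) \<in> arcs M" "B = {min x y, max x y}"
    using B by (auto simp: arcs_def min_def max_def insert_commute)
  then show "B \<in> (\<lambda>(a, b). {a, b}) ` arcs M" by force
qed (auto simp: arcs_def)

lemma finite_arcs:
  assumes "matching n M"
  shows "finite (arcs M)"
  by (rule finite_subset[of _ "{1..2 * n} \<times> {1..2 * n}"]) (use arcs_bounds[OF assms] in auto)

section \<open>Nestings and the pattern P1\<close>

text \<open>Both forbidden configurations are nestings with adjacent openers or adjacent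
  closers.\<close>

lemma nonnesting_stoimenow: "nonnesting M \<Longrightarrow> stoimenow M"
  unfolding nonnesting_def stoimenow_def by (metis less_add_one)

text \<open>In \<open>P1\<close> the arc [4,5] is nested in [2,7], and an increasing relabelling
  reflects nestings.\<close>

lemma contains_P1_nesting:
  assumes "matching n M" "matching_contains M P1"
  shows "\<not> nonnesting M"
proof -
  obtain N f where N: "N \<subseteq> M" "strict_mono_on (\<Union>N) f" "(`) f ` N = P1"
    using assms(2) by (auto simp: matching_contains_def)
  have refl: "f u < f v \<Longrightarrow> u < v" if "u \<in> \<Union>N" "v \<in> \<Union>N" for u v
    using N(2) that by (meson strict_mono_on_less)
  have "{2, 7} \<in> (`) f ` N" "{4, 5} \<in> (`) f ` N" by (simp_all add: N(3) P1_def)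
  then obtain B B' where B: "B \<in> N" "{2, 7} = f ` B" "B' \<in> N" "{4, 5} = f ` B'" by blast
  then have "2 \<in> f ` B" "7 \<in> f ` B" "4 \<in> f ` B'" "5 \<in> f ` B'" by blast+
  then obtain a b c d where *: "a \<in> B" "2 = f a" "b \<in> B" "7 = f b"
      "c \<in> B'" "4 = f c" "d \<in> B'" "5 = f d"
    by blast
  have "a \<in> \<Union>N" "b \<in> \<Union>N" "c \<in> \<Union>N" "d \<in> \<Union>N" using * B by blast+
  then have "a < b" "c < d" "a < c" "d < b"
    by (simp_all add: refl flip: *(2,4,6,8))
  moreover have "(a, b) \<in> arcs M" "(c, d) \<in> arcs M"
    using block_arc(2)[OF assms(1)] * B N(1) \<open>a < b\<close> \<open>c < d\<close> by blast+
  ultimately show ?thesis unfolding nonnesting_def by blast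
qed

lemma contains_P1_if_arcs:
  assumes "(x, y) \<in> arcs M" "(a, b) \<in> arcs M" "(c, d) \<in> arcs M" "(z, w) \<in> arcs M"
    and less: "x < a" "a < y" "y < c" "c < d" "d < z" "z < b" "b < w"
  shows "matching_contains M P1"
proof -
  define N where "N = {{x, y}, {a, b}, {c, d}, {z, w}}"
  \<comment> \<open>A step function that takes the values 1 to 8 at the eight endpoints in
    increasing order.\<close>
  define f :: "nat \<Rightarrow> nat" where
    "f v = (if v \<le> x then 1 else if v \<le> a then 2 else if v \<le> y then 3 else if v \<le> c then 4
      else if v \<le> d then 5 else if v \<le> z then 6 else if v \<le> b then 7 else 8)" for v
  have f: "f x = 1" "f a = 2" "f y = 3" "f c = 4" "f d = 5" "f z = 6" "f b = 7" "f w = 8"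
    using less by (auto simp: f_def)
  have U: "\<Union>N = {x, a, y, c, d, z, b, w}" by (auto simp: N_def)
  have "card (\<Union>N) = 8" unfolding U using less by simp
  moreover have "f ` \<Union>N = {1..8}"
    unfolding U by (auto simp: f atLeastAtMost_iff)
  moreover have "strict_mono_on (\<Union>N) f"
    unfolding U by (rule strict_mono_onI) (use less f in auto)
  moreover have "(`) f ` N = P1" by (simp add: N_def P1_def f)
  moreover have "N \<subseteq> M" using assms(1-4) by (auto simp: N_def arcs_def)
  ultimately show ?thesis unfolding matching_contains_def by metis
qed

text \<open>Among the arcs nested in $[a,b]$, let $c$ be the leftmost opener and $d$ the rightmost closer.
  Since \<open>M\<close> is Stoimenow, $c-1$ closes an arc starting left of $a$ and $d+1$ opens an arc ending
  right of $b$.\<close>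

lemma nesting_contains_P1:
  assumes M: "matching n M" "stoimenow M" and nest: "\<not> nonnesting M"
  shows "matching_contains M P1"
proof -
  obtain a b c0 d0 where ab: "(a, b) \<in> arcs M" "(c0, d0) \<in> arcs M" "a < c0" "d0 < b"
    using nest by (auto simp: nonnesting_def)
  define X where "X = {(c, d) \<in> arcs M. a < c \<and> d < b}"
  have X: "finite X" "(c0, d0) \<in> X"
    using finite_arcs[OF M(1)] ab by (auto simp: X_def intro: finite_subset)
  define c where "c = Min (fst ` X)"
  define d where "d = Max (snd ` X)"
  have "c \<in> fst ` X" unfolding c_def by (rule Min_in) (use X in auto)
  then obtain d1 where c: "(c, d1) \<in> arcs M" "a < c" "d1 < b" by (auto simp: X_def)
  have "d \<in> snd ` X" unfolding d_def by (rule Max_in) (use X in auto)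
  then obtain c1 where d: "(c1, d) \<in> arcs M" "a < c1" "d < b" by (auto simp: X_def)
  have c_min: "c \<le> c'" and d_max: "d' \<le> d" if "(c', d') \<in> arcs M" "a < c'" "d' < b" for c' d'
    unfolding c_def d_def using X(1) that by (force simp: X_def intro!: Min_le Max_ge)+
  have bounds: "1 \<le> a" "b \<le> 2 * n" using arcs_bounds[OF M(1) ab(1)] by auto
  have less: "c < d1" "c1 < d" using c d arcs_less by blast+
  have left: "\<not> (\<exists>i k l. (i, l) \<in> arcs M \<and> (i + 1, k) \<in> arcs M \<and> i + 1 < k \<and> k < l)"
    and right: "\<not> (\<exists>k l j. (k, j + 1) \<in> arcs M \<and> (l, j) \<in> arcs M \<and> k < l \<and> l < j)"
    using M(2) unfolding stoimenow_def by blast+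
  \<comment> \<open>Such an arc would enclose the arc from \<open>c\<close> to \<open>d1\<close> and
    have an adjacent opener. The arc excluded by \<open>right\<close> would likewise enclose the one
    from \<open>c1\<close> to \<open>d\<close>.\<close>
  have left: False if "(c - 1, q) \<in> arcs M" "b \<le> q" for q
  proof -
    have "c - 1 + 1 = c" using c(2) by simp
    then show False using left that c(1,3) less(1) by (metis less_le_trans)
  qed
  have right: False if "(k, d + 1) \<in> arcs M" "k \<le> a" for k
    using right that d(1,2) less(2) by (meson le_less_trans)
  have "c - 1 \<in> {1..2 * n}" "d + 1 \<in> {1..2 * n}" using c d less bounds by auto
  note pc = arc_cases[OF M(1) this(1)] and pd = arc_cases[OF M(1) this(2)]
  have "a \<noteq> c - 1" using left[of b] ab(1) by auto
  then have "a < c - 1" using c(2) by simp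
  \<comment> \<open>If \<open>c - 1\<close> were an opener, its arc would end before
    \<open>b\<close> by \<open>left\<close>, and hence be a nested arc starting left of
    \<open>c\<close>.\<close>
  obtain x where x: "(x, c - 1) \<in> arcs M"
  proof (rule pc)
    fix q assume q: "(c - 1, q) \<in> arcs M"
    then have "q < b" using left[of q] by (meson not_le)
    then have "c \<le> c - 1" using c_min q \<open>a < c - 1\<close> by blast
    then show thesis using \<open>a < c - 1\<close> by simp
  qed
  have "x < a"
  proof (rule ccontr)
    assume "\<not> x < a"
    moreover have "x \<noteq> a" using arcs_eqI[OF M(1) x ab(1)] c less by auto
    ultimately have "c \<le> x" using c_min[OF x] c less by simp
    then show False using arcs_less[OF x] by simp
  qed
  have "b \<noteq> d + 1" using right[of a] ab(1) by auto
  then have "d + 1 < b" using d(3) by simp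
  obtain w where w: "(d + 1, w) \<in> arcs M"
  proof (rule pd)
    fix k assume k: "(k, d + 1) \<in> arcs M"
    then have "a < k" using right[of k] by (meson not_le)
    then have "d + 1 \<le> d" using d_max k \<open>d + 1 < b\<close> by blast
    then show thesis by simp
  qed
  have "b < w"
  proof (rule ccontr)
    assume "\<not> b < w"
    moreover have "w \<noteq> b" using arcs_eqI[OF M(1) w ab(1)] d less by auto
    ultimately have "w \<le> d" using d_max[OF w] d less by simp
    then show False using arcs_less[OF w] by simp
  qed
  have "c \<le> c0" "d0 \<le> d" using c_min d_max ab by blast+
  \<comment> \<open>The original nested arc serves as [4,5]; its endpoints lie between
    \<open>c\<close> and \<open>d\<close>, hence strictly between \<open>c - 1\<close> and
    \<open>d + 1\<close>.\<close>
  show ?thesis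
    by (rule contains_P1_if_arcs[OF x ab(1,2) w])
       (use \<open>x < a\<close> \<open>a < c - 1\<close> \<open>c \<le> c0\<close> \<open>d0 \<le> d\<close> \<open>d + 1 < b\<close> \<open>b < w\<close> arcs_less[OF ab(2)] in auto)
qed

lemma stoimenow_matchings_avoiding_P1:
  "stoimenow_matchings_avoiding n P1 = {M. matching n M \<and> nonnesting M}"
  unfolding stoimenow_matchings_avoiding_def stoimenow_matchings_def
  using contains_P1_nesting nesting_contains_P1 nonnesting_stoimenow by blast

section \<open>Opener-closer words\<close>

definition word :: "nat \<Rightarrow> nat set \<Rightarrow> int list" where
  "word n A = map (\<lambda>j. if j \<in> A then 1 else -1) [1..<Suc (2 * n)]"

lemma length_word [simp]: "length (word n A) = 2 * n"
  by (simp add: word_def)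

lemma set_word: "set (word n A) \<subseteq> {1, -1}"
  by (auto simp: word_def)

lemma sum_take_word:
  assumes "k \<le> 2 * n"
  shows "sum_list (take k (word n A)) = int (card ({1..k} \<inter> A)) - int (card ({1..k} - A))"
proof -
  have "take k [1..<Suc (2 * n)] = [1..<Suc k]"
    using assms by (subst take_upt) auto
  then have "sum_list (take k (word n A)) = (\<Sum>j\<in>{1..k}. if j \<in> A then 1 else -1)"
    by (simp add: word_def take_map interv_sum_list_conv_sum_set_nat atLeastLessThanSuc_atLeastAtMost
        del: upt_Suc)
  also have "\<dots> = int (card ({1..k} \<inter> A)) - int (card ({1..k} - A))"
    by (simp add: sum.If_cases Diff_eq)
  finally show ?thesis .
qed

lemma word_inject:
  assumes "A \<subseteq> {1..2 * n}" "B \<subseteq> {1..2 * n}" "word n A = word n B"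
  shows "A = B"
proof -
  have "j \<in> A \<longleftrightarrow> j \<in> B" if "j \<in> {1..2 * n}" for j
    using assms(3) that by (auto simp: word_def less_Suc_eq_le simp del: upt_Suc split: if_splits)
  then show ?thesis using assms(1,2) by blast
qed

lemma word_surj:
  assumes "set \<mu> \<subseteq> {1, -1}" "length \<mu> = 2 * n"
  shows "word n {j \<in> {1..2 * n}. \<mu> ! (j - 1) = 1} = \<mu>"
proof (rule nth_equalityI)
  fix i assume i: "i < length (word n {j \<in> {1..2 * n}. \<mu> ! (j - 1) = 1})"
  then have "\<mu> ! i \<in> set \<mu>" using assms(2) by simp
  then have "\<mu> ! i \<in> {1, -1}" using assms(1) by blast
  then show "word n {j \<in> {1..2 * n}. \<mu> ! (j - 1) = 1} ! i = \<mu> ! i"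
    using i by (auto simp: word_def nth_append simp del: upt_Suc)
qed (simp add: assms)

definition openers :: "nat set set \<Rightarrow> nat set" where "openers M = fst ` arcs M"

lemma openers_closers:
  assumes "matching n M"
  shows "openers M \<subseteq> {1..2 * n}" "{1..2 * n} - openers M = snd ` arcs M"
proof -
  show "openers M \<subseteq> {1..2 * n}"
    using arcs_bounds[OF assms] by (auto simp: openers_def)
  show "{1..2 * n} - openers M = snd ` arcs M"
  proof (intro equalityI subsetI)
    fix p assume p: "p \<in> {1..2 * n} - openers M"
    then have "p \<in> {1..2 * n}" by simp
    then show "p \<in> snd ` arcs M"
      by (rule arc_cases[OF assms]) (use p in \<open>force simp: openers_def\<close>)+
  next
    fix p assume "p \<in> snd ` arcs M"
    then obtain q where q: "(q, p) \<in> arcs M" by auto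
    have "p \<notin> openers M"
    proof
      assume "p \<in> openers M"
      then obtain r where "(p, r) \<in> arcs M" by (auto simp: openers_def)
      then have "(q, p) = (p, r)" using arcs_eqI[OF assms q] by simp
      then show False using arcs_less[OF q] by simp
    qed
    then show "p \<in> {1..2 * n} - openers M" using arcs_bounds[OF assms q] by simp
  qed
qed

lemma inj_on_arcs:
  assumes "matching n M"
  shows "inj_on fst (arcs M)" "inj_on snd (arcs M)"
proof -
  have "x = y" if "x \<in> arcs M" "y \<in> arcs M" "fst x = fst y \<or> snd x = snd y" for x y
    using arcs_eqI[OF assms, of "fst x" "snd x" "fst y" "snd y"] that by auto
  then show "inj_on fst (arcs M)" "inj_on snd (arcs M)"
    unfolding inj_on_def by blast+
qed

text \<open>An arc closed by \<open>k\<close> was also opened by \<open>k\<close>, so openers minus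
  closers up to \<open>k\<close> counts the arcs still open.\<close>

lemma sum_take_word_openers:
  assumes "matching n M" "k \<le> 2 * n"
  shows "sum_list (take k (word n (openers M))) = int (card {(a, b) \<in> arcs M. a \<le> k \<and> k < b})"
proof -
  note fin = finite_arcs[OF assms(1)]
  note oc = openers_closers[OF assms(1)]
  have "{1..k} \<inter> openers M = fst ` {x \<in> arcs M. fst x \<le> k}"
    using oc(1) by (force simp: openers_def)
  then have o: "card ({1..k} \<inter> openers M) = card {x \<in> arcs M. fst x \<le> k}"
    using inj_on_arcs(1)[OF assms(1)] by (auto intro!: card_image intro: inj_on_subset)
  have "{1..k} - openers M = {1..k} \<inter> ({1..2 * n} - openers M)" using assms(2) by auto
  also have "\<dots> = snd ` {x \<in> arcs M. snd x \<le> k}"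
    unfolding oc(2) using arcs_bounds(2)[OF assms(1)] by force
  finally have c: "card ({1..k} - openers M) = card {x \<in> arcs M. snd x \<le> k}"
    using inj_on_arcs(2)[OF assms(1)] by (auto intro!: card_image intro: inj_on_subset)
  have "{x \<in> arcs M. fst x \<le> k} =
      {x \<in> arcs M. snd x \<le> k} \<union> {(a, b) \<in> arcs M. a \<le> k \<and> k < b}"
    using arcs_less by fastforce
  then have "card {x \<in> arcs M. fst x \<le> k} =
      card ({x \<in> arcs M. snd x \<le> k} \<union> {(a, b) \<in> arcs M. a \<le> k \<and> k < b})"
    by (rule arg_cong)
  also have "\<dots> = card {x \<in> arcs M. snd x \<le> k} + card {(a, b) \<in> arcs M. a \<le> k \<and> k < b}"
    by (rule card_Un_disjoint) (use fin in \<open>auto intro: finite_subset[OF _ fin]\<close>)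
  finally show ?thesis
    unfolding sum_take_word[OF assms(2)] o c by simp
qed

text \<open>The heights are cardinalities, hence nonnegative, and no arc is open after position
  \<open>2 * n\<close>.\<close>

lemma word_openers_dyck:
  assumes "matching n M"
  shows "word n (openers M) \<in> dyck_paths n"
proof -
  have "{(a, b) \<in> arcs M. a \<le> 2 * n \<and> 2 * n < b} = {}"
    by (auto dest: arcs_bounds(2)[OF assms])
  then have "sum_list (take (2 * n) (word n (openers M))) = 0"
    unfolding sum_take_word_openers[OF assms order_refl] by (simp only: card.empty of_nat_0)
  then show ?thesis
    using sum_take_word_openers[OF assms] set_word by (simp add: dyck_paths_def)
qed

section \<open>Crossings of nonnesting matchings\<close>

text \<open>The arcs are sorted lexicographically, thus by openers; without nestings the closers
  come in the same order.\<close>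

lemma nonnesting_sorted_arcs:
  assumes "matching n M" "nonnesting M" "S \<subseteq> arcs M"
  shows "set (sorted_list_of_set S) = S"
    "sorted_wrt (<) (map fst (sorted_list_of_set S))"
    "sorted_wrt (<) (map snd (sorted_list_of_set S))"
proof -
  have "finite S" using assms(3) finite_arcs[OF assms(1)] by (rule finite_subset)
  then show set: "set (sorted_list_of_set S) = S" by simp
  have *: "fst x < fst y \<and> snd x < snd y" if "x \<in> S" "y \<in> S" "x < y" for x y
  proof -
    obtain a b c d where xy: "x = (a, b)" "y = (c, d)" by fastforce
    have arcs: "(a, b) \<in> arcs M" "(c, d) \<in> arcs M" using that assms(3) xy by auto
    then have "a \<noteq> c" "b \<noteq> d"
      using arcs_eqI[OF assms(1) arcs] that(3) xy by auto
    moreover have "a \<le> c" using that(3) xy by auto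
    ultimately have "a < c" by simp
    moreover from this have "\<not> d < b" using assms(2) arcs unfolding nonnesting_def by blast
    ultimately show ?thesis using \<open>b \<noteq> d\<close> xy by simp
  qed
  have "sorted_wrt (<) (sorted_list_of_set S)" by simp
  then have "sorted_wrt (\<lambda>x y. fst x < fst y \<and> snd x < snd y) (sorted_list_of_set S)"
    by (rule sorted_wrt_mono_rel[rotated]) (simp add: * set)
  then show "sorted_wrt (<) (map fst (sorted_list_of_set S))"
    "sorted_wrt (<) (map snd (sorted_list_of_set S))"
    unfolding sorted_wrt_map by (auto elim: sorted_wrt_mono_rel[rotated])
qed

lemma cr_eq_height:
  assumes "matching n M" "nonnesting M"
  shows "cr M = height (word n (openers M))"
proof -
  note fin = finite_arcs[OF assms(1)]
  define V where "V k = {(a, b) \<in> arcs M. a \<le> k \<and> k < b}" for k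
  have finV: "finite (V k)" for k
    using fin by (rule finite_subset[rotated]) (auto simp: V_def)
  define K where "K = {k. \<exists>C. crossing M k C}"
  have upper: "\<exists>p\<le>2 * n. k \<le> card (V p)" if crossing: "crossing M k C" for k C
  proof -
    obtain cs where cs: "set cs \<subseteq> arcs M" "length cs = k"
      "sorted_wrt (<) (map fst cs @ map snd cs)"
      using crossing by (auto simp: crossing_def)
    show ?thesis
    proof (cases "cs = []")
      case False
      \<comment> \<open>At the last opener of a crossing all its arcs have been opened and none has
        been closed.\<close>
      define p where "p = fst (last cs)"
      have "last cs \<in> arcs M" using cs(1) False by auto
      then have "p \<le> 2 * n"
        using arcs_bounds(1)[OF assms(1), of p "snd (last cs)"] by (simp add: p_def)
      have srt: "sorted_wrt (<) (map fst cs)"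
        "\<And>x y. x \<in> set cs \<Longrightarrow> y \<in> set cs \<Longrightarrow> fst x < snd y"
        using cs(3) by (auto simp: sorted_wrt_append)
      have le: "fst x \<le> p" if x: "x \<in> set cs" for x
      proof -
        obtain i where i: "i < length cs" "x = cs ! i" using x by (auto simp: in_set_conv_nth)
        have "sorted (map fst cs)" using srt(1) by (simp add: strict_sorted_iff)
        then have "map fst cs ! i \<le> map fst cs ! (length cs - 1)"
          using i by (intro sorted_nth_mono) auto
        then show ?thesis using i False by (simp add: p_def last_conv_nth)
      qed
      have "set cs \<subseteq> V p"
      proof
        fix x assume x: "x \<in> set cs"
        then have "p < snd x" using srt(2)[of "last cs" x] False by (simp add: p_def)
        then show "x \<in> V p" using le[OF x] cs(1) x by (cases x) (auto simp: V_def)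
      qed
      then have "card (set cs) \<le> card (V p)" by (rule card_mono[OF finV])
      moreover have "distinct cs"
        using srt(1) by (simp add: strict_sorted_iff distinct_map)
      ultimately show ?thesis using cs(2) \<open>p \<le> 2 * n\<close> by (metis distinct_card)
    qed (use cs(2) in auto)
  qed
  have lower: "card (V p) \<in> K" for p
  proof -
    have sub: "V p \<subseteq> arcs M" by (auto simp: V_def)
    note srt = nonnesting_sorted_arcs[OF assms sub]
    \<comment> \<open>Within \<open>V p\<close> every opener is at most \<open>p\<close> and every
      closer exceeds \<open>p\<close>.\<close>
    have "sorted_wrt (<) (map fst (sorted_list_of_set (V p)) @ map snd (sorted_list_of_set (V p)))"
      unfolding sorted_wrt_append using srt(2,3)
      by (auto simp: finV) (auto simp: V_def)
    then have "crossing M (card (V p)) (V p)"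
      unfolding crossing_def using sub srt(1)
      by (intro conjI exI[of _ "sorted_list_of_set (V p)"]) auto
    then show ?thesis by (auto simp: K_def)
  qed
  \<comment> \<open>Needed for finiteness of \<open>K\<close>, without which its \<open>Max\<close>
    would carry no information.\<close>
  have "K \<subseteq> {..card (arcs M)}"
  proof
    fix k assume "k \<in> K"
    then obtain p where "k \<le> card (V p)" using upper by (auto simp: K_def)
    also have "\<dots> \<le> card (arcs M)" using fin by (intro card_mono) (auto simp: V_def)
    finally show "k \<in> {..card (arcs M)}" by simp
  qed
  then have finK: "finite K" by (rule finite_subset) simp
  have "cr M \<le> w \<longleftrightarrow> height (word n (openers M)) \<le> w" for w
  proof -
    have "cr M \<le> w \<longleftrightarrow> (\<forall>k\<in>K. k \<le> w)"
      unfolding cr_def K_def[symmetric] using finK lower by (subst Max_le_iff) auto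
    also have "\<dots> \<longleftrightarrow> (\<forall>p\<le>2 * n. card (V p) \<le> w)"
      using upper lower unfolding K_def by (blast intro: order_trans)
    also have "\<dots> \<longleftrightarrow> height (word n (openers M)) \<le> w"
      unfolding height_le_iff using sum_take_word_openers[OF assms(1)] by (auto simp: V_def)
    finally show ?thesis .
  qed
  then show ?thesis by (metis le_antisym order_refl)
qed

section \<open>Nonnesting matchings correspond to Dyck paths\<close>

text \<open>Listing the arcs by openers also lists the closers in order, so the openers determine
  the matching.\<close>

lemma nonnesting_arcs_eq_zip:
  assumes "matching n M" "nonnesting M"
  shows "arcs M = set (zip (sorted_list_of_set (openers M))
    (sorted_list_of_set ({1..2 * n} - openers M)))"
proof -
  define cs where "cs = sorted_list_of_set (arcs M)"
  note srt = nonnesting_sorted_arcs[OF assms order_refl, folded cs_def]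
  have "map fst cs = sorted_list_of_set (openers M)"
    using srt(1,2) by (intro strict_sorted_equal)
      (auto simp: openers_def finite_arcs[OF assms(1)])
  moreover have "map snd cs = sorted_list_of_set ({1..2 * n} - openers M)"
    using srt(1,3) unfolding openers_closers(2)[OF assms(1)] by (intro strict_sorted_equal)
      (auto simp: finite_arcs[OF assms(1)])
  ultimately show ?thesis using srt(1) zip_map_fst_snd[of cs] by metis
qed

text \<open>Pair the openers and closers of the word in order; nonnegative heights put each opener
  before its closer.\<close>

lemma ex_nonnesting_matching:
  assumes "\<mu> \<in> dyck_paths n"
  obtains M where "matching n M" "nonnesting M" "word n (openers M) = \<mu>"
proof -
  have \<mu>: "set \<mu> \<subseteq> {1, -1}" "length \<mu> = 2 * n" "sum_list \<mu> = 0"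
    "\<And>k. k \<le> 2 * n \<Longrightarrow> 0 \<le> sum_list (take k \<mu>)"
    using assms by (auto simp: dyck_paths_def)
  define A where "A = {j \<in> {1..2 * n}. \<mu> ! (j - 1) = 1}"
  define B where "B = {1..2 * n} - A"
  have word: "word n A = \<mu>" unfolding A_def by (rule word_surj[OF \<mu>(1,2)])
  have AB: "finite A" "finite B" "A \<union> B = {1..2 * n}" "A \<inter> B = {}" by (auto simp: A_def B_def)
  have prefix: "card ({1..k} - A) \<le> card ({1..k} \<inter> A)" if "k \<le> 2 * n" for k
    using \<mu>(4)[OF that] sum_take_word[OF that, of A] word by simp
  have "{1..2 * n} \<inter> A = A" by (auto simp: A_def)
  then have card: "card A = card B"
    using sum_take_word[OF order_refl, of n A] word \<mu>(2,3) by (simp add: B_def)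
  define os where "os = sorted_list_of_set A"
  define cl where "cl = sorted_list_of_set B"
  have os: "set os = A" "length os = card A" "sorted_wrt (<) os"
    and cl: "set cl = B" "length cl = card A" "sorted_wrt (<) cl"
    using AB card by (auto simp: os_def cl_def)
  \<comment> \<open>Otherwise the prefix ending at \<open>p = cl ! i\<close> contains at least
    \<open>i + 1\<close> closers. As \<open>p\<close> is not an opener, all openers in it precede
    \<open>os ! i\<close>, so there are at most \<open>i\<close> of them.\<close>
  have less: "os ! i < cl ! i" if i: "i < card A" for i
  proof (rule ccontr)
    assume ng: "\<not> os ! i < cl ! i"
    define p where "p = cl ! i"
    have "p \<in> B" using i cl by (auto simp: p_def)
    then have p: "p \<in> {1..2 * n}" by (simp add: B_def)
    have "(!) cl ` {..i} \<subseteq> {1..p} - A"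
    proof
      fix v assume "v \<in> (!) cl ` {..i}"
      then obtain k where k: "k \<le> i" "v = cl ! k" by auto
      then have "v \<in> B" using i cl by auto
      moreover have "v \<le> p"
        unfolding k(2) p_def using i k(1) cl(2,3)
        by (cases "k = i") (auto simp: sorted_wrt_iff_nth_less less_imp_le)
      ultimately show "v \<in> {1..p} - A" by (auto simp: B_def)
    qed
    then have "card ((!) cl ` {..i}) \<le> card ({1..p} - A)" by (intro card_mono) auto
    moreover have "card ((!) cl ` {..i}) = Suc i"
      using cl i by (subst card_image)
        (auto intro!: inj_on_nth simp: strict_sorted_iff)
    moreover have "{1..p} \<inter> A \<subseteq> (!) os ` {..<i}"
    proof
      fix v assume v: "v \<in> {1..p} \<inter> A"
      then obtain k where k: "k < length os" "v = os ! k" using os(1) by (metis IntD2 in_set_conv_nth)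
      have "v \<noteq> p" using v \<open>p \<in> B\<close> AB(4) by blast
      then have "os ! k < os ! i" using v k ng by (auto simp: p_def)
      then have "k < i"
        using os(3) k(1) by (metis linorder_neqE_nat less_asym sorted_wrt_nth_less i os(2) less_irrefl)
      then show "v \<in> (!) os ` {..<i}" using k by auto
    qed
    then have "card ({1..p} \<inter> A) \<le> card ((!) os ` {..<i})" by (intro card_mono) auto
    moreover have "card ((!) os ` {..<i}) \<le> i"
      using card_image_le[of "{..<i}" "(!) os"] by simp
    ultimately show False using prefix[of p] p by simp
  qed
  define Z where "Z = set (zip os cl)"
  have Z: "(a, b) \<in> Z \<longleftrightarrow> (\<exists>i<card A. a = os ! i \<and> b = cl ! i)" for a b
    using os(2) cl(2) by (auto simp: Z_def in_set_zip)
  have fst_Z: "fst ` Z = A" and snd_Z: "snd ` Z = B"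
    unfolding Z_def using os cl by (simp_all flip: set_map)
  define M where "M = (\<lambda>(a, b). {a, b}) ` Z"
  have Z_less: "a < b" if "(a, b) \<in> Z" for a b using that less by (auto simp: Z)
  have arcs: "arcs M = Z"
    unfolding arcs_def M_def using Z_less by (fastforce simp: doubleton_eq_iff dest: less_asym)
  have dist: "distinct os" "distinct cl" using os(3) cl(3) by (auto simp: strict_sorted_iff)
  have nth_eq: "os ! i = os ! j \<longleftrightarrow> i = j" "cl ! i = cl ! j \<longleftrightarrow> i = j" "os ! i \<noteq> cl ! j"
    "cl ! j \<noteq> os ! i" if "i < card A" "j < card A" for i j
    using that dist os cl AB(4) nth_eq_iff_index_eq by (metis, metis, (metis disjoint_iff nth_mem)+)
  have "matching n M"
    unfolding matching_def
  proof
    show "partition_on {1..2 * n} M"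
      unfolding partition_on_def
    proof (intro conjI)
      have "\<Union>M = fst ` Z \<union> snd ` Z" by (force simp: M_def)
      then show "\<Union>M = {1..2 * n}" using fst_Z snd_Z AB(3) by simp
      show "disjoint M"
      proof (rule disjointI)
        fix X Y assume "X \<in> M" "Y \<in> M" "X \<noteq> Y"
        then show "X \<inter> Y = {}" by (auto simp: M_def Z nth_eq)
      qed
    qed (auto simp: M_def)
    show "\<forall>B\<in>M. card B = 2" using Z_less by (fastforce simp: M_def)
  qed
  moreover have "nonnesting M"
    unfolding nonnesting_def arcs
  proof
    assume "\<exists>a b c d. (a, b) \<in> Z \<and> (c, d) \<in> Z \<and> a < c \<and> d < b"
    then obtain i j where "i < card A" "j < card A" "os ! i < os ! j" "cl ! j < cl ! i"
      by (auto simp: Z)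
    then show False using os cl
      by (metis less_asym linorder_neqE_nat sorted_wrt_nth_less less_irrefl)
  qed
  moreover have "word n (openers M) = \<mu>" by (simp add: openers_def arcs fst_Z word)
  ultimately show thesis by (rule that)
qed

lemma bij_betw_word_openers:
  "bij_betw (\<lambda>M. word n (openers M)) {M. matching n M \<and> nonnesting M} (dyck_paths n)"
proof (rule bij_betwI')
  fix M M' assume *: "M \<in> {M. matching n M \<and> nonnesting M}" "M' \<in> {M. matching n M \<and> nonnesting M}"
  show "word n (openers M) = word n (openers M') \<longleftrightarrow> M = M'"
  proof
    assume "word n (openers M) = word n (openers M')"
    then have "openers M = openers M'"
      by (intro word_inject[of _ n] openers_closers(1)) (use * in simp_all)
    then have "arcs M = arcs M'"
      using nonnesting_arcs_eq_zip[of n M] nonnesting_arcs_eq_zip[of n M'] *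
      by (simp only: mem_Collect_eq)
    have "M = (\<lambda>(a, b). {a, b}) ` arcs M" using * by (intro matching_eq_arcs) auto
    also have "\<dots> = (\<lambda>(a, b). {a, b}) ` arcs M'" using \<open>arcs M = arcs M'\<close> by simp
    also have "\<dots> = M'" using * by (intro matching_eq_arcs[symmetric]) auto
    finally show "M = M'" .
  qed simp
next
  fix \<mu> assume "\<mu> \<in> dyck_paths n"
  then obtain M where "matching n M" "nonnesting M" "word n (openers M) = \<mu>"
    by (rule ex_nonnesting_matching)
  then show "\<exists>M\<in>{M. matching n M \<and> nonnesting M}. \<mu> = word n (openers M)" by blast
qed (use word_openers_dyck in auto)

lemma sum_stoimenow_matchings_avoiding_P1:
  "(\<Sum>M\<in>stoimenow_matchings_avoiding n P1. F (cr M)) = (\<Sum>\<mu>\<in>dyck_paths n. F (height \<mu>))"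
proof -
  have "(\<Sum>M\<in>stoimenow_matchings_avoiding n P1. F (cr M)) =
      (\<Sum>M | matching n M \<and> nonnesting M. F (height (word n (openers M))))"
    unfolding stoimenow_matchings_avoiding_P1 by (rule sum.cong) (auto simp: cr_eq_height)
  also have "\<dots> = (\<Sum>\<mu>\<in>dyck_paths n. F (height \<mu>))"
    by (rule sum.reindex_bij_betw[OF bij_betw_word_openers])
  finally show ?thesis .
qed

theorem theorem1p3:
  fixes n :: nat
  shows "(\<Sum>M\<in>stoimenow_matchings_avoiding n P1. monom (1 :: int) (cr M)) =
           (\<Sum>C\<in>posets_avoiding_22_and n three_plus_one. monom (1 :: int) (class_width C)) \<and>
         (\<Sum>C\<in>posets_avoiding_22_and n three_plus_one. monom (1 :: int) (class_width C)) =
           (\<Sum>C\<in>posets_avoiding_22_and n N_poset. monom (1 :: int) (class_width C)) \<and>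
         (\<Sum>C\<in>posets_avoiding_22_and n N_poset. monom (1 :: int) (class_width C)) =
           (\<Sum>\<mu>\<in>dyck_paths n. monom (1 :: int) (height \<mu>))"
  unfolding sum_stoimenow_matchings_avoiding_P1 sum_posets_avoiding_31 sum_posets_avoiding_N
  by simp

end
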